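(* Let $n\ge 1$ and let $v$ be a non-zero element of $\mathbb{C}^n$. Then the complex $n$-dimensional vector space $$\mathcal{E}_v=\{\phi_a:\mathrm{SL}_n(\mathbb{R})\to\mathbb{C}\mid \phi_a(x)=\operatorname{trace}(v^t a x^t),\ a\in\mathbb{C}^n\}$$ is an eigenfamily on the semi-Riemannian Lie group $\mathrm{SL}_n(\mathbb{R})$ such that for all $\phi,\psi\in\mathcal{E}_v$ we have $$\tau(\phi)=-\frac{(n^2-1)}{n}\cdot\phi,\qquad\kappa(\phi,\psi)=-\frac{(n-1)}{n}\cdot\phi\cdot\psi.$$
   Context: Elements of $\mathbb{C}^n$ are row vectors, so $v^ta$ is the $n\times n$ matrix $(v_ja_\alpha)_{j\alpha}$. The Lie group $\mathrm{SL}_n(\mathbb{R})$ carries the left-invariant semi-Riemannian metric $g$ determined by $g(Z,W)=-\operatorname{Re}\operatorname{trace}(ZW)=-\operatorname{trace}(ZW)$ on its Lie algebra $\mathfrak{sl}_n(\mathbb{R})=\{X\in\mathbb{R}^{n\times n}\mid\operatorname{trace}X=0\}$. For smooth complex-valued functions $\phi,\psi$, $\tau(\phi)=\operatorname{div}(\nabla\phi)$ is the Laplace-Beltrami operator (tension field) and $\kappa(\phi,\psi)=g(\nabla\phi,\nabla\psi)$ is the conformality operator, where $g$ is extended complex-bilinearly to the complexified tangent bundle. A set $\mathcal{E}$ of complex-valued functions is an eigenfamily if there exist $\lambda,\mu\in\mathbb{C}$ with $\tau(\phi)=\lambda\phi$ and $\kappa(\phi,\psi)=\mu\phi\psi$ for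 all $\phi,\psi\in\mathcal{E}$. *)

theory Defs
  imports "HOL-Analysis.Analysis" "HOL-Library.Function_Algebras"
begin

section \<open>The special linear group and smooth maps on it\<close>

text \<open>\<open>SL\<^sub>n(\<real>)\<close> is made a type, so that maps on it are plain HOL functions and equality of maps
  is equality on the group. The index type \<open>'n\<close> has \<open>n = CARD('n) \<ge> 1\<close> elements.\<close>

typedef (overloaded) 'n SL = "{A :: real^'n^'n::finite. det A = 1}"
  morphisms mat_of_SL SL_of_mat
  by (rule exI[of _ "mat 1"]) simp

definition sl :: "(real^'n^'n) set"
  where "sl = {Z. trace Z = 0}"

text \<open>Tangent vectors are matrices: \<open>T\<^sub>p SL\<^sub>n(\<real>) = p \<cdot> sl\<^sub>n(\<real>)\<close>.\<close>

definition tangent :: "'n::finite SL \<Rightarrow> (real^'n^'n) set"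
  where "tangent p = (\<lambda>Z. mat_of_SL p ** Z) ` sl"

text \<open>\<open>C\<^sup>k\<close> on an open subset of a Euclidean space, by iterated directional derivatives.\<close>

primrec Ck_on :: "nat \<Rightarrow> 'a::euclidean_space set \<Rightarrow> ('a \<Rightarrow> 'b::real_normed_vector) \<Rightarrow> bool"
  where
    "Ck_on 0 U f \<longleftrightarrow> continuous_on U f"
  | "Ck_on (Suc k) U f \<longleftrightarrow>
       f differentiable_on U \<and> (\<forall>v. Ck_on k U (\<lambda>x. frechet_derivative f (at x) v))"

text \<open>Maps on the submanifold \<open>SL\<^sub>n(\<real>)\<close> are smooth iff they extend locally to smooth maps
  on open sets of matrices.\<close>

definition smooth :: "('n::finite SL \<Rightarrow> 'b::real_normed_vector) \<Rightarrow> bool"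
  where "smooth f \<longleftrightarrow>
    (\<forall>p. \<exists>U F. open U \<and> mat_of_SL p \<in> U \<and> (\<forall>k. Ck_on k U F)
      \<and> (\<forall>q. mat_of_SL q \<in> U \<longrightarrow> F (mat_of_SL q) = f q))"

text \<open>The differential \<open>df\<^sub>p(u) = (f \<circ> c)'(0)\<close>, for any curve \<open>c\<close> in the group
  with \<open>c(0) = p\<close> and \<open>c'(0) = u\<close>.\<close>

definition differential :: "('n::finite SL \<Rightarrow> real) \<Rightarrow> 'n SL \<Rightarrow> real^'n^'n \<Rightarrow> real"
  where "differential f p u =
    (THE d. \<forall>c. c 0 = p \<and> ((\<lambda>t. mat_of_SL (c t)) has_vector_derivative u) (at 0)
       \<longrightarrow> ((\<lambda>t::real. f (c t)) has_real_derivative d) (at 0))"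

definition vector_field :: "('n::finite SL \<Rightarrow> real^'n^'n) \<Rightarrow> bool"
  where "vector_field X \<longleftrightarrow> smooth X \<and> (\<forall>p. X p \<in> tangent p)"

definition field_deriv :: "('n::finite SL \<Rightarrow> real^'n^'n) \<Rightarrow> ('n SL \<Rightarrow> real) \<Rightarrow> 'n SL \<Rightarrow> real"
  where "field_deriv X f p = differential f p (X p)"

definition left_invariant_field :: "real^'n^'n \<Rightarrow> 'n::finite SL \<Rightarrow> real^'n^'n"
  where "left_invariant_field Z p = mat_of_SL p ** Z"


section \<open>Left-invariant metric, Levi-Civita connection, gradient and divergence\<close>

definition lie_metric :: "real^'n^'n \<Rightarrow> real^'n^'n \<Rightarrow> real"
  where "lie_metric Z W = - trace (Z ** W)"

definition metric :: "'n::finite SL \<Rightarrow> real^'n^'n \<Rightarrow> real^'n^'n \<Rightarrow> real"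
  where "metric p u w =
    lie_metric (matrix_inv (mat_of_SL p) ** u) (matrix_inv (mat_of_SL p) ** w)"

text \<open>The last two conditions say that the connection is torsion-free,
  \<open>\<nabla>\<^sub>X Y - \<nabla>\<^sub>Y X = [X, Y]\<close> as derivations on smooth functions, and compatible with the metric.\<close>

definition levi_civita ::
    "(('n::finite SL \<Rightarrow> real^'n^'n) \<Rightarrow> ('n SL \<Rightarrow> real^'n^'n) \<Rightarrow> ('n SL \<Rightarrow> real^'n^'n)) \<Rightarrow> bool"
  where "levi_civita D \<longleftrightarrow>
    (\<forall>X Y. vector_field X \<longrightarrow> vector_field Y \<longrightarrow> vector_field (D X Y)) \<and>
    (\<forall>X X' Y. vector_field X \<longrightarrow> vector_field X' \<longrightarrow> vector_field Y \<longrightarrow>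
       D (\<lambda>p. X p + X' p) Y = (\<lambda>p. D X Y p + D X' Y p)) \<and>
    (\<forall>f X Y. smooth f \<longrightarrow> vector_field X \<longrightarrow> vector_field Y \<longrightarrow>
       D (\<lambda>p. f p *\<^sub>R X p) Y = (\<lambda>p. f p *\<^sub>R D X Y p)) \<and>
    (\<forall>X Y Y'. vector_field X \<longrightarrow> vector_field Y \<longrightarrow> vector_field Y' \<longrightarrow>
       D X (\<lambda>p. Y p + Y' p) = (\<lambda>p. D X Y p + D X Y' p)) \<and>
    (\<forall>f X Y. smooth f \<longrightarrow> vector_field X \<longrightarrow> vector_field Y \<longrightarrow>
       D X (\<lambda>p. f p *\<^sub>R Y p) = (\<lambda>p. field_deriv X f p *\<^sub>R Y p + f p *\<^sub>R D X Y p)) \<and>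
    (\<forall>f X Y. smooth f \<longrightarrow> vector_field X \<longrightarrow> vector_field Y \<longrightarrow>
       (\<forall>p. field_deriv (D X Y) f p - field_deriv (D Y X) f p =
            field_deriv X (field_deriv Y f) p - field_deriv Y (field_deriv X f) p)) \<and>
    (\<forall>X Y Z. vector_field X \<longrightarrow> vector_field Y \<longrightarrow> vector_field Z \<longrightarrow>
       (\<forall>p. field_deriv X (\<lambda>q. metric q (Y q) (Z q)) p =
            metric p (D X Y p) (Z p) + metric p (Y p) (D X Z p)))"

text \<open>By the fundamental theorem of semi-Riemannian geometry such a connection exists and its values
  on (smooth) vector fields are unique. Hilbert choice only leaves open its irrelevant values
  on arguments that are not vector fields.\<close>

definition nabla ::
    "('n::finite SL \<Rightarrow> real^'n^'n) \<Rightarrow> ('n SL \<Rightarrow> real^'n^'n) \<Rightarrow> ('n SL \<Rightarrow> real^'n^'n)"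
  where "nabla = (SOME D. levi_civita D)"

text \<open>\<open>\<nabla>\<^sub>u Y\<close> for a single tangent vector \<open>u\<close> at \<open>p\<close>. The value of \<open>\<nabla>\<^sub>X Y\<close> at \<open>p\<close> depends
  on \<open>X\<close> only through \<open>X(p)\<close>, so \<open>u\<close> may be extended to a left-invariant field.\<close>

definition nabla_at :: "'n::finite SL \<Rightarrow> real^'n^'n \<Rightarrow> ('n SL \<Rightarrow> real^'n^'n) \<Rightarrow> real^'n^'n"
  where "nabla_at p u Y = nabla (left_invariant_field (matrix_inv (mat_of_SL p) ** u)) Y p"

text \<open>Trace of a linear endomorphism \<open>T\<close> of the subspace \<open>S\<close>, which does not depend on
  the basis \<open>B\<close> of \<open>S\<close>.\<close>

definition endo_trace :: "'a::real_vector set \<Rightarrow> ('a \<Rightarrow> 'a) \<Rightarrow> real"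
  where "endo_trace S T =
    (let B = (SOME B. independent B \<and> span B = S) in \<Sum>b\<in>B. representation B (T b) b)"

definition divergence :: "('n::finite SL \<Rightarrow> real^'n^'n) \<Rightarrow> 'n SL \<Rightarrow> real"
  where "divergence Y p = endo_trace (tangent p) (\<lambda>u. nabla_at p u Y)"

definition gradient :: "('n::finite SL \<Rightarrow> real) \<Rightarrow> 'n SL \<Rightarrow> real^'n^'n"
  where "gradient f p =
    (THE u. u \<in> tangent p \<and> (\<forall>w\<in>tangent p. metric p u w = differential f p w))"


section \<open>Complex-linear extensions and eigenfamilies\<close>

definition complex_metric :: "'n::finite SL \<Rightarrow> complex^'n^'n \<Rightarrow> complex^'n^'n \<Rightarrow> complex"
  where "complex_metric p u w = Complex
    (metric p (map_matrix Re u) (map_matrix Re w) - metric p (map_matrix Im u) (map_matrix Im w))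
    (metric p (map_matrix Re u) (map_matrix Im w) + metric p (map_matrix Im u) (map_matrix Re w))"

definition complex_gradient :: "('n::finite SL \<Rightarrow> complex) \<Rightarrow> 'n SL \<Rightarrow> complex^'n^'n"
  where "complex_gradient \<phi> p = (\<chi> i j.
    Complex (gradient (\<lambda>q. Re (\<phi> q)) p $ i $ j) (gradient (\<lambda>q. Im (\<phi> q)) p $ i $ j))"

definition complex_divergence :: "('n::finite SL \<Rightarrow> complex^'n^'n) \<Rightarrow> 'n SL \<Rightarrow> complex"
  where "complex_divergence Y p = Complex
    (divergence (\<lambda>q. map_matrix Re (Y q)) p) (divergence (\<lambda>q. map_matrix Im (Y q)) p)"

definition tension :: "('n::finite SL \<Rightarrow> complex) \<Rightarrow> 'n SL \<Rightarrow> complex"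
  where "tension \<phi> = complex_divergence (complex_gradient \<phi>)"

definition conformality ::
    "('n::finite SL \<Rightarrow> complex) \<Rightarrow> ('n SL \<Rightarrow> complex) \<Rightarrow> 'n SL \<Rightarrow> complex"
  where "conformality \<phi> \<psi> p = complex_metric p (complex_gradient \<phi> p) (complex_gradient \<psi> p)"

definition eigenfamily :: "('n::finite SL \<Rightarrow> complex) set \<Rightarrow> bool"
  where "eigenfamily E \<longleftrightarrow> (\<forall>\<phi>\<in>E. smooth \<phi>) \<and>
    (\<exists>lam \<mu>. \<forall>\<phi>\<in>E. \<forall>\<psi>\<in>E. (\<forall>x. tension \<phi> x = lam * \<phi> x) \<and>
       (\<forall>x. conformality \<phi> \<psi> x = \<mu> * \<phi> x * \<psi> x))"


section \<open>The family \<open>\<E>\<^sub>v\<close>\<close>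

text \<open>The matrix \<open>v\<^sup>t a\<close> for row vectors \<open>v\<close> and \<open>a\<close>.\<close>

definition row_outer :: "complex^'n \<Rightarrow> complex^'n \<Rightarrow> complex^'n^'n"
  where "row_outer v a = (\<chi> j \<alpha>. v $ j * a $ \<alpha>)"

definition phi :: "complex^'n \<Rightarrow> complex^'n \<Rightarrow> 'n::finite SL \<Rightarrow> complex"
  where "phi v a x = trace (row_outer v a ** transpose (map_matrix complex_of_real (mat_of_SL x)))"

definition family :: "complex^'n \<Rightarrow> ('n::finite SL \<Rightarrow> complex) set"
  where "family v = {phi v a | a. True}"

definition fun_scale :: "complex \<Rightarrow> ('a \<Rightarrow> complex) \<Rightarrow> 'a \<Rightarrow> complex"
  where "fun_scale c f = (\<lambda>x. c * f x)"

lemma vector_space_fun_scale: "vector_space fun_scale"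
  by unfold_locales (auto simp: fun_scale_def fun_eq_iff algebra_simps)

end

theory Submission
  imports Defs
begin

text \<open>The trace form is bi-invariant, so the Levi-Civita connection is
  \<open>\<nabla>\<^sub>X Y = dY(X) - (X p\<^sup>-\<^sup>1 Y + Y p\<^sup>-\<^sup>1 X) / 2\<close> for matrix-valued fields. Real and imaginary parts of
  \<open>\<phi>\<^sub>a\<close> are functions \<open>f(p) = trace (M\<^sup>t p)\<close>, with gradient
  \<open>trace (M\<^sup>t p) / n \<cdot> p - p M\<^sup>t p\<close>. The endomorphism \<open>u \<mapsto> \<nabla>\<^sub>u (grad f)\<close> extends to all matrices with
  values in the tangent space, so its trace may be computed over the matrix units, which gives
  \<open>(1/n - n) f\<close>. For the conformality operator, \<open>v\<^sup>t a\<close> and \<open>v\<^sup>t b\<close> having rank one with the same \<open>v\<close>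
  factors the quadratic term as \<open>\<phi>\<^sub>a \<phi>\<^sub>b\<close>.\<close>

section \<open>Smooth maps between Euclidean spaces\<close>

text \<open>\<open>differential\<close>, \<open>gradient\<close> and \<open>nabla\<close> are given
  by description or choice, so a formula may replace them only after existence and uniqueness are
  proved. Uniqueness of the differential needs a curve in the group for every tangent vector;
  uniqueness of the gradient and of the connection needs nondegeneracy of the trace form on
  \<open>sl\<close>. Existence of the connection forces analysis in the ambient matrix space:
  torsion is stated through iterated derivatives of arbitrary smooth functions, and the condition
  reduces to symmetry of the second derivative of a local extension. Hence the calculus of
  \<open>Ck_on\<close>, and the passage from \<open>vdiff\<close> on the group to
  \<open>frechet_derivative\<close> of an extension.\<close>

lemma Ck_on_cong:
  fixes f g :: "'a::euclidean_space \<Rightarrow> 'b::real_normed_vector"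
  assumes "open U" "\<And>x. x \<in> U \<Longrightarrow> f x = g x" "Ck_on k U f"
  shows "Ck_on k U g"
  using assms(2,3)
proof (induction k arbitrary: f g)
  case 0
  then show ?case by (simp cong: continuous_on_cong)
next
  case (Suc k)
  have g: "(g has_derivative frechet_derivative f (at x)) (at x)" if "x \<in> U" for x
    using Suc.prems assms(1) that
    by (intro has_derivative_transform_within_open[of f _ x UNIV U g])
       (auto simp: differentiable_on_eq_differentiable_at frechet_derivative_works)
  then have fg: "frechet_derivative f (at x) = frechet_derivative g (at x)" if "x \<in> U" for x
    using frechet_derivative_at that by blast
  have "g differentiable_on U"
    using g by (meson assms(1) differentiableI differentiable_on_eq_differentiable_at)
  moreover have "Ck_on k U (\<lambda>x. frechet_derivative g (at x) v)" for v
  proof (rule Suc.IH)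
    show "Ck_on k U (\<lambda>x. frechet_derivative f (at x) v)"
      using Suc.prems by simp
  qed (simp add: fg)
  ultimately show ?case by simp
qed

lemma Ck_on_subset:
  assumes "Ck_on k U f" "V \<subseteq> U"
  shows "Ck_on k V f"
  using assms
  by (induction k arbitrary: f) (auto intro: continuous_on_subset differentiable_on_subset)

lemma Ck_on_SucD: "Ck_on (Suc k) U f \<Longrightarrow> Ck_on k U f"
proof (induction k arbitrary: f)
  case 0
  then show ?case by (simp add: differentiable_imp_continuous_on)
next
  case (Suc k)
  then show ?case by (metis Ck_on.simps(2))
qed

lemma Ck_on_Suc_has_derivative:
  assumes "open U" "x \<in> U" "Ck_on (Suc k) U f"
  shows "(f has_derivative frechet_derivative f (at x)) (at x)"
  using assms by (auto simp: differentiable_on_eq_differentiable_at frechet_derivative_works)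

text \<open>Lets the derivative be any formula \<open>f'\<close> obtained from the derivative rules,
  without first evaluating \<open>frechet_derivative f\<close>.\<close>

lemma Ck_on_SucI:
  assumes "open U" "\<And>x. x \<in> U \<Longrightarrow> (f has_derivative f' x) (at x)"
    and "\<And>v. Ck_on k U (\<lambda>x. f' x v)"
  shows "Ck_on (Suc k) U f"
proof -
  have "f' x = frechet_derivative f (at x)" if "x \<in> U" for x
    using assms(2)[OF that] by (rule frechet_derivative_at)
  then have "Ck_on k U (\<lambda>x. frechet_derivative f (at x) v)" for v
    by (intro Ck_on_cong[OF assms(1) _ assms(3)[of v]]) simp
  moreover have "f differentiable_on U"
    using assms(1,2) differentiableI differentiable_on_eq_differentiable_at by blast
  ultimately show ?thesis by simp
qed

lemma Ck_on_const: "open U \<Longrightarrow> Ck_on k U (\<lambda>x. c)"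
  by (induction k arbitrary: c) simp_all

lemma Ck_on_bounded_linear:
  assumes "bounded_linear f" "open U"
  shows "Ck_on k U f"
proof (cases k)
  case 0
  then show ?thesis using assms by (simp add: linear_continuous_on)
next
  case (Suc m)
  show ?thesis unfolding Suc
    by (rule Ck_on_SucI[OF assms(2) bounded_linear_imp_has_derivative[OF assms(1)]])
       (rule Ck_on_const[OF assms(2)])
qed

lemma Ck_on_compose_bounded_linear:
  assumes "bounded_linear h" "open U" "Ck_on k U f"
  shows "Ck_on k U (\<lambda>x. h (f x))"
  using assms(3)
proof (induction k arbitrary: f)
  case 0
  then show ?case using assms(1) by (simp add: bounded_linear.continuous_on)
next
  case (Suc k)
  show ?case
    by (rule Ck_on_SucI[OF assms(2)], rule bounded_linear.has_derivative[OF assms(1)],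
        erule Ck_on_Suc_has_derivative[OF assms(2) _ Suc.prems])
       (use Suc in simp)
qed

lemma Ck_on_add:
  assumes "open U" "Ck_on k U f" "Ck_on k U g"
  shows "Ck_on k U (\<lambda>x. f x + g x)"
  using assms(2,3)
proof (induction k arbitrary: f g)
  case 0
  then show ?case by (simp add: continuous_on_add)
next
  case (Suc k)
  show ?case
  proof (rule Ck_on_SucI[OF assms(1)])
    show "((\<lambda>x. f x + g x) has_derivative
        (\<lambda>v. frechet_derivative f (at x) v + frechet_derivative g (at x) v)) (at x)" if "x \<in> U" for x
      using that Suc.prems by (intro has_derivative_add Ck_on_Suc_has_derivative[OF assms(1)])
  qed (use Suc in simp)
qed

lemma Ck_on_sum:
  assumes "open U" "\<And>i. i \<in> I \<Longrightarrow> Ck_on k U (f i)"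
  shows "Ck_on k U (\<lambda>x. \<Sum>i\<in>I. f i x)"
  using assms(2)
  by (induction I rule: infinite_finite_induct) (simp_all add: Ck_on_add Ck_on_const assms(1))

lemma Ck_on_bilinear:
  assumes "bounded_bilinear h" "open U" "Ck_on k U f" "Ck_on k U g"
  shows "Ck_on k U (\<lambda>x. h (f x) (g x))"
  using assms(3,4)
proof (induction k arbitrary: f g)
  case 0
  then show ?case using assms(1) by (simp add: bounded_bilinear.continuous_on)
next
  case (Suc k)
  \<comment> \<open>In each product-rule term one factor is not differentiated;
    \<open>Ck_on_SucD\<close> lowers it to the order that the induction hypothesis expects.\<close>
  have "Ck_on k U (\<lambda>x. h (f x) (frechet_derivative g (at x) v) + h (frechet_derivative f (at x) v) (g x))" for v
    using Suc Ck_on_SucD[of k U f] Ck_on_SucD[of k U g]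
    by (intro Ck_on_add[OF assms(2)] Suc.IH) auto
  then show ?case
    using Suc.prems
    by (intro Ck_on_SucI[OF assms(2), where f' = "\<lambda>x v. h (f x) (frechet_derivative g (at x) v)
            + h (frechet_derivative f (at x) v) (g x)"]
        bounded_bilinear.FDERIV[OF assms(1)] Ck_on_Suc_has_derivative[OF assms(2)])
qed

lemma Ck_on_prod:
  fixes f :: "'i \<Rightarrow> 'a::euclidean_space \<Rightarrow> 'b::{real_normed_algebra,comm_ring_1}"
  assumes "open U" "\<And>i. i \<in> I \<Longrightarrow> Ck_on k U (f i)"
  shows "Ck_on k U (\<lambda>x. \<Prod>i\<in>I. f i x)"
  using assms(2)
  by (induction I rule: infinite_finite_induct)
     (simp_all add: Ck_on_bilinear[OF bounded_bilinear_mult] Ck_on_const assms(1))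

section \<open>Derivatives in varying directions and symmetry of second derivatives\<close>

lemma linear_expand_Basis:
  fixes f :: "'a::euclidean_space \<Rightarrow> 'b::real_vector"
  assumes "linear f"
  shows "f v = (\<Sum>b\<in>Basis. (v \<bullet> b) *\<^sub>R f b)"
proof -
  have "f v = f (\<Sum>b\<in>Basis. (v \<bullet> b) *\<^sub>R b)" by (simp add: euclidean_representation)
  also have "\<dots> = (\<Sum>b\<in>Basis. (v \<bullet> b) *\<^sub>R f b)"
    by (simp add: linear_sum[OF assms] linear_cmul[OF assms])
  finally show ?thesis .
qed

lemma frechet_derivative_expand_Basis:
  assumes "open U" "x \<in> U" "Ck_on (Suc k) U f"
  shows "frechet_derivative f (at x) v = (\<Sum>b\<in>Basis. (v \<bullet> b) *\<^sub>R frechet_derivative f (at x) b)"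
  by (rule linear_expand_Basis)
     (rule has_derivative_linear[OF Ck_on_Suc_has_derivative[OF assms]])

text \<open>\<open>Ck_on\<close> only controls derivatives in a fixed direction. Expanding the
  moving direction \<open>g x\<close> in \<open>Basis\<close> leaves finitely many fixed ones, with
  coefficients as smooth as \<open>g\<close>.\<close>

lemma Ck_on_frechet_derivative:
  assumes "open U" "Ck_on (Suc k) U f" "Ck_on k U g"
  shows "Ck_on k U (\<lambda>x. frechet_derivative f (at x) (g x))"
proof (rule Ck_on_cong[OF assms(1)])
  show "(\<Sum>b\<in>Basis. (g x \<bullet> b) *\<^sub>R frechet_derivative f (at x) b) = frechet_derivative f (at x) (g x)"
    if "x \<in> U" for x
    by (rule frechet_derivative_expand_Basis[OF assms(1) that assms(2), symmetric])
  show "Ck_on k U (\<lambda>x. \<Sum>b\<in>Basis. (g x \<bullet> b) *\<^sub>R frechet_derivative f (at x) b)"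
  proof (intro Ck_on_sum[OF assms(1)] Ck_on_bilinear[OF bounded_bilinear_scaleR assms(1)])
    show "Ck_on k U (\<lambda>x. g x \<bullet> b)" for b
      by (rule Ck_on_compose_bounded_linear[OF bounded_linear_inner_left assms(1,3)])
    show "Ck_on k U (\<lambda>x. frechet_derivative f (at x) b)" for b
      using assms(2) by simp
  qed
qed

lemma has_derivative_along_curve:
  assumes "(F has_derivative F') (at (c t))" "(c has_vector_derivative v) (at t)"
  shows "((\<lambda>t. F (c t)) has_vector_derivative F' v) (at t)"
  using vector_derivative_diff_chain_within[OF assms(2) has_derivative_at_withinI[OF assms(1)]]
  by (simp add: o_def)

text \<open>The second difference \<open>F (x + h b + h c) - F (x + h b) - F (x + h c) + F x\<close> is
  \<open>h\<^sup>2\<close> times a value of the mixed derivative close to \<open>x\<close>, in either order of differentiation.\<close>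

lemma second_difference:
  fixes F :: "'a::euclidean_space \<Rightarrow> real"
  assumes "Ck_on 2 (ball x r) F" "h > 0" "h * (norm b + norm c) < r"
  shows "\<exists>y\<in>cball x (h * (norm b + norm c)).
    F (x + h *\<^sub>R b + h *\<^sub>R c) - F (x + h *\<^sub>R b) - F (x + h *\<^sub>R c) + F x
      = h\<^sup>2 * frechet_derivative (\<lambda>z. frechet_derivative F (at z) b) (at y) c"
proof -
  let ?U = "ball x r"
  let ?D = "\<lambda>z. frechet_derivative F (at z) b"
  have mem: "norm (s *\<^sub>R b + t *\<^sub>R c) \<le> h * (norm b + norm c)" if "0 \<le> s" "s \<le> h" "0 \<le> t" "t \<le> h" for s t
  proof -
    have "norm (s *\<^sub>R b + t *\<^sub>R c) \<le> s * norm b + t * norm c"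
      using that by (metis abs_of_nonneg norm_scaleR norm_triangle_ineq)
    also have "\<dots> \<le> h * norm b + h * norm c"
      using that by (intro add_mono mult_right_mono) auto
    finally show ?thesis by (simp add: algebra_simps)
  qed
  have inU: "x + s *\<^sub>R b + t *\<^sub>R c \<in> ?U" if "0 \<le> s" "s \<le> h" "0 \<le> t" "t \<le> h" for s t
  proof -
    have "dist x (x + s *\<^sub>R b + t *\<^sub>R c) = norm (s *\<^sub>R b + t *\<^sub>R c)"
      by (metis add.assoc add_diff_cancel_left' dist_commute dist_norm)
    then show ?thesis
      using order_le_less_trans[OF mem[OF that] assms(3)] by simp
  qed
  have F1: "Ck_on (Suc 1) ?U F" and D1: "Ck_on (Suc 0) ?U ?D"
    using assms(1) by (simp_all add: numeral_2_eq_2)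
  note dF = Ck_on_Suc_has_derivative[OF open_ball _ F1]
  note dD = Ck_on_Suc_has_derivative[OF open_ball _ D1]
  have der: "((\<lambda>t. G (l t)) has_real_derivative G' v) (at t)"
    if "(l has_vector_derivative v) (at t)" "(G has_derivative G') (at (l t))"
    for G G' and l :: "real \<Rightarrow> 'a" and v t
    using has_derivative_along_curve[OF that(2,1)]
    by (simp add: has_real_derivative_iff_has_vector_derivative)
  have derF: "((\<lambda>s. F (x + s *\<^sub>R b + t *\<^sub>R c)) has_real_derivative ?D (x + s *\<^sub>R b + t *\<^sub>R c)) (at s)"
    if "0 \<le> s" "s \<le> h" "0 \<le> t" "t \<le> h" for s t
    by (rule der[where l = "\<lambda>s. x + s *\<^sub>R b + t *\<^sub>R c", OF _ dF[OF inU[OF that]]])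
       (auto intro!: derivative_eq_intros)
  have derD: "((\<lambda>t. ?D (x + s *\<^sub>R b + t *\<^sub>R c)) has_real_derivative
      frechet_derivative ?D (at (x + s *\<^sub>R b + t *\<^sub>R c)) c) (at t)"
    if "0 \<le> s" "s \<le> h" "0 \<le> t" "t \<le> h" for s t
    by (rule der[where l = "\<lambda>t. x + s *\<^sub>R b + t *\<^sub>R c", OF _ dD[OF inU[OF that]]])
       (auto intro!: derivative_eq_intros)
  \<comment> \<open>Mean value theorem in the direction \<open>b\<close>, applied to the difference
    of the edges \<open>t = h\<close> and \<open>t = 0\<close>; the term
    \<open>0 *\<^sub>R c\<close> stays so that \<open>derF\<close> fits both edges.\<close>
  have "((\<lambda>s. F (x + s *\<^sub>R b + h *\<^sub>R c) - F (x + s *\<^sub>R b + 0 *\<^sub>R c)) has_real_derivative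
      ?D (x + s *\<^sub>R b + h *\<^sub>R c) - ?D (x + s *\<^sub>R b + 0 *\<^sub>R c)) (at s)" if "0 \<le> s" "s \<le> h" for s
    using that assms(2) by (intro DERIV_diff derF) simp_all
  from MVT2[OF assms(2) this] obtain s where s: "0 < s" "s < h" and
    s_eq: "(F (x + h *\<^sub>R b + h *\<^sub>R c) - F (x + h *\<^sub>R b + 0 *\<^sub>R c)) - (F (x + 0 *\<^sub>R b + h *\<^sub>R c) - F (x + 0 *\<^sub>R b + 0 *\<^sub>R c))
      = (h - 0) * (?D (x + s *\<^sub>R b + h *\<^sub>R c) - ?D (x + s *\<^sub>R b + 0 *\<^sub>R c))"
    by blast
  have "((\<lambda>t. ?D (x + s *\<^sub>R b + t *\<^sub>R c)) has_real_derivative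
      frechet_derivative ?D (at (x + s *\<^sub>R b + t *\<^sub>R c)) c) (at t)" if "0 \<le> t" "t \<le> h" for t
    using that s by (intro derD) simp_all
  from MVT2[OF assms(2) this] obtain t where t: "0 < t" "t < h" and
    t_eq: "?D (x + s *\<^sub>R b + h *\<^sub>R c) - ?D (x + s *\<^sub>R b + 0 *\<^sub>R c)
      = (h - 0) * frechet_derivative ?D (at (x + s *\<^sub>R b + t *\<^sub>R c)) c"
    by blast
  show ?thesis
  proof (rule bexI)
    show "x + s *\<^sub>R b + t *\<^sub>R c \<in> cball x (h * (norm b + norm c))"
    proof -
      have "dist x (x + s *\<^sub>R b + t *\<^sub>R c) = norm (s *\<^sub>R b + t *\<^sub>R c)"
        by (metis add.assoc add_diff_cancel_left' dist_commute dist_norm)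
      then show ?thesis
        using mem[of s t] s t by simp
    qed
  qed (use s_eq t_eq in \<open>simp add: power2_eq_square\<close>)
qed

text \<open>Each mixed derivative, at some point near \<open>x\<close>, equals the second difference
  divided by \<open>h\<^sup>2\<close>, and that difference is unchanged when \<open>b\<close> and
  \<open>c\<close> are exchanged. Continuity brings both points back to \<open>x\<close>.\<close>

lemma frechet_derivative_commute:
  fixes F :: "'a::euclidean_space \<Rightarrow> real"
  assumes "open U" "x \<in> U" "Ck_on 2 U F"
  shows "frechet_derivative (\<lambda>z. frechet_derivative F (at z) b) (at x) c
    = frechet_derivative (\<lambda>z. frechet_derivative F (at z) c) (at x) b" (is "?f x = ?g x")
proof -
  obtain r where r: "r > 0" "ball x r \<subseteq> U"
    using assms(1,2) open_contains_ball by blast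
  have F: "Ck_on 2 (ball x r) F"
    by (rule Ck_on_subset[OF assms(3) r(2)])
  have cont: "isCont ?f x" "isCont ?g x"
    using assms by (simp_all add: numeral_2_eq_2 continuous_on_eq_continuous_at)
  have "\<bar>?f x - ?g x\<bar> \<le> e" if "e > 0" for e
  proof -
    obtain d1 where d1: "d1 > 0" "\<And>y. dist y x < d1 \<Longrightarrow> dist (?f y) (?f x) < e/2"
      using cont(1) half_gt_zero[OF \<open>e > 0\<close>] unfolding continuous_at_eps_delta by metis
    obtain d2 where d2: "d2 > 0" "\<And>y. dist y x < d2 \<Longrightarrow> dist (?g y) (?g x) < e/2"
      using cont(2) half_gt_zero[OF \<open>e > 0\<close>] unfolding continuous_at_eps_delta by metis
    define m where "m = Min {r, d1, d2}"
    have m: "0 < m" "m \<le> r" "m \<le> d1" "m \<le> d2"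
      using r(1) d1(1) d2(1) by (auto simp: m_def)
    define N where "N = norm b + norm c"
    have "N \<ge> 0" by (simp add: N_def)
    \<comment> \<open>Small enough for \<open>h * N < m\<close>; the added 1 keeps the denominator
      positive when \<open>b\<close> and \<open>c\<close> vanish.\<close>
    define h where "h = m / (2 * (N + 1))"
    have h: "h > 0"
      using m(1) \<open>N \<ge> 0\<close> by (simp add: h_def)
    have hN: "h * N < m"
    proof -
      have "h * N < h * (2 * (N + 1))"
        using h \<open>N \<ge> 0\<close> by (intro mult_strict_left_mono) auto
      also have "\<dots> = m" using \<open>N \<ge> 0\<close> by (simp add: h_def)
      finally show ?thesis .
    qed
    have "h * (norm b + norm c) < r" "h * (norm c + norm b) < r"
      using hN m(2) by (simp_all add: N_def add.commute)
    note second_difference[OF F h this(1)] second_difference[OF F h this(2)]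
    then obtain y z where yz: "dist x y \<le> h * N" "dist x z \<le> h * N"
      and y: "F (x + h *\<^sub>R b + h *\<^sub>R c) - F (x + h *\<^sub>R b) - F (x + h *\<^sub>R c) + F x = h\<^sup>2 * ?f y"
      and z: "F (x + h *\<^sub>R c + h *\<^sub>R b) - F (x + h *\<^sub>R c) - F (x + h *\<^sub>R b) + F x = h\<^sup>2 * ?g z"
      unfolding N_def by (auto simp: add.commute[of "norm c"])
    have "x + h *\<^sub>R c + h *\<^sub>R b = x + h *\<^sub>R b + h *\<^sub>R c" by simp
    have "h\<^sup>2 * ?f y = h\<^sup>2 * ?g z"
      using y z by (simp only: \<open>x + h *\<^sub>R c + h *\<^sub>R b = x + h *\<^sub>R b + h *\<^sub>R c\<close>)
    then have "?f y = ?g z" using h by simp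
    moreover have "\<bar>?f y - ?f x\<bar> < e/2" "\<bar>?g z - ?g x\<bar> < e/2"
      using d1(2)[of y] d2(2)[of z] yz hN m by (auto simp: dist_real_def dist_commute)
    ultimately show ?thesis by linarith
  qed
  then show ?thesis
    using field_le_epsilon[of "\<bar>?f x - ?g x\<bar>" 0] by simp
qed


section \<open>Curves in the special linear group\<close>

lemma matrix_add_rdistrib: "(A + B) ** C = A ** C + B ** C"
  by (vector matrix_matrix_mult_def sum.distrib[symmetric] field_simps)

lemma bounded_bilinear_matrix_mult:
  "bounded_bilinear ((**) :: real^'m^'n \<Rightarrow> real^'p^'m \<Rightarrow> real^'p^'n)"
  unfolding bilinear_conv_bounded_bilinear[symmetric] bilinear_def
  by (auto intro!: linearI
      simp: matrix_add_ldistrib matrix_add_rdistrib matrix_scalar_ac scalar_matrix_assoc)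

interpretation matrix_mult: bounded_bilinear "(**) :: real^'m^'n \<Rightarrow> real^'p^'m \<Rightarrow> real^'p^'n"
  by (rule bounded_bilinear_matrix_mult)

lemma linear_trace: "linear (trace :: real^'n^'n \<Rightarrow> real)"
  by (rule linearI) (simp_all add: trace_def sum.distrib sum_distrib_left)

lemma bounded_linear_trace: "bounded_linear (trace :: real^'n^'n \<Rightarrow> real)"
  using linear_trace by (rule linear_conv_bounded_linear[THEN iffD1])

lemma matrix_inv_eq:
  fixes A :: "real^'n^'n"
  assumes "A ** B = mat 1" "B ** A = mat 1"
  shows "matrix_inv A = B"
proof -
  have "A ** matrix_inv A = mat 1 \<and> matrix_inv A ** A = mat 1"
    unfolding matrix_inv_def by (rule someI) (use assms in blast)
  then have "matrix_inv A = (B ** A) ** matrix_inv A"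
    by (simp add: assms)
  also have "\<dots> = B ** (A ** matrix_inv A)"
    by (simp add: matrix_mul_assoc)
  finally show ?thesis
    using \<open>A ** matrix_inv A = mat 1 \<and> _\<close> by simp
qed

lemma matrix_expand_axis:
  fixes A :: "real^'m^'n"
  shows "A = (\<Sum>i\<in>UNIV. \<Sum>j\<in>UNIV. A $ i $ j *\<^sub>R axis i (axis j 1))"
proof -
  have "(\<Sum>i\<in>UNIV. \<Sum>j\<in>UNIV. A $ i $ j *\<^sub>R axis i (axis j 1)) $ a $ b = A $ a $ b" for a b
  proof -
    have "(\<Sum>i\<in>UNIV. \<Sum>j\<in>UNIV. A $ i $ j *\<^sub>R axis i (axis j 1)) $ a $ b
      = (\<Sum>i\<in>UNIV. if i = a then \<Sum>j\<in>UNIV. if j = b then A $ i $ j else 0 else 0)"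
      unfolding sum_component
    proof (rule sum.cong[OF refl])
      show "(\<Sum>j\<in>UNIV. (A $ i $ j *\<^sub>R axis i (axis j 1)) $ a $ b)
        = (if i = a then \<Sum>j\<in>UNIV. if j = b then A $ i $ j else 0 else 0)" for i
        by (cases "i = a") (simp_all add: axis_def if_distrib[of "(*) _"] cong: if_cong)
    qed
    then show ?thesis by (simp only: sum.delta finite UNIV_I if_True)
  qed
  then show ?thesis by (simp only: vec_eq_iff simp_thms)
qed

lemma Ck_on_matrixI:
  fixes F :: "'a::euclidean_space \<Rightarrow> real^'m^'n"
  assumes "open U" "\<And>i j. Ck_on k U (\<lambda>x. F x $ i $ j)"
  shows "Ck_on k U F"
proof -
  have "Ck_on k U (\<lambda>x. \<Sum>i\<in>UNIV. \<Sum>j\<in>UNIV. F x $ i $ j *\<^sub>R axis i (axis j 1 :: real^'m))"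
    by (intro Ck_on_sum Ck_on_compose_bounded_linear[OF bounded_linear_scaleR_left] assms)
  then show ?thesis by (simp only: matrix_expand_axis[symmetric])
qed

lemma Ck_on_det:
  fixes F :: "'a::euclidean_space \<Rightarrow> real^'n^'n"
  assumes "open U" "\<And>i j. Ck_on k U (\<lambda>x. F x $ i $ j)"
  shows "Ck_on k U (\<lambda>x. det (F x))"
  unfolding det_def
  by (intro Ck_on_sum assms Ck_on_compose_bounded_linear[OF bounded_linear_mult_right] Ck_on_prod)

lemma bounded_linear_matrix_entry: "bounded_linear (\<lambda>x :: real^'m^'n. x $ i $ j)"
  by (rule bounded_linear_compose[OF bounded_linear_vec_nth bounded_linear_vec_nth])

text \<open>The classical adjugate in the form that Cramer's rule produces. Being polynomial in the
  entries, it extends inversion on the group to a smooth map on all matrices.\<close>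

definition adjugate :: "real^'n^'n \<Rightarrow> real^'n^'n"
  where "adjugate A = (\<chi> k l. det (\<chi> i j. if j = k then mat 1 $ i $ l else A $ i $ j))"

lemma Ck_on_adjugate: "open U \<Longrightarrow> Ck_on k U adjugate"
proof (intro Ck_on_matrixI)
  fix a b
  assume U: "open U"
  have "Ck_on k U (\<lambda>A. det (\<chi> i j. if j = a then mat 1 $ i $ b else A $ i $ j))"
  proof (rule Ck_on_det[OF U])
    fix i j
    show "Ck_on k U (\<lambda>A. (\<chi> i j. if j = a then mat 1 $ i $ b else A $ i $ j) $ i $ j)"
      by (cases "j = a") (simp_all add: U Ck_on_const Ck_on_bounded_linear bounded_linear_matrix_entry)
  qed
  then show "Ck_on k U (\<lambda>A. adjugate A $ a $ b)" by (simp add: adjugate_def)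
qed

text \<open>Column l of the inverse solves A x = e_l, and with determinant 1 Cramer's rule returns
  its entries without division.\<close>

lemma matrix_inv_eq_adjugate:
  fixes A :: "real^'n^'n"
  assumes "det A = 1"
  shows "A ** matrix_inv A = mat 1" "matrix_inv A ** A = mat 1" "matrix_inv A = adjugate A"
proof -
  obtain B where B: "A ** B = mat 1" "B ** A = mat 1"
    using assms invertible_det_nz[of A] unfolding invertible_def by auto
  note inv = matrix_inv_eq[OF B]
  show "A ** matrix_inv A = mat 1" "matrix_inv A ** A = mat 1"
    by (simp_all add: inv B)
  have "B $ k $ l = adjugate A $ k $ l" for k l
  proof -
    have "A *v column l B = (\<chi> i. (A ** B) $ i $ l)"
      by (simp add: matrix_vector_mult_def matrix_matrix_mult_def column_def)
    then have "A *v column l B = (\<chi> i. mat 1 $ i $ l)"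
      by (simp add: B)
    then have "(\<chi> i j. if j = k then (A *v column l B) $ i else A $ i $ j)
        = (\<chi> i j. if j = k then mat 1 $ i $ l else A $ i $ j)"
      by (simp add: vec_eq_iff)
    then have "adjugate A $ k $ l = column l B $ k * det A"
      unfolding cramer_lemma[symmetric] by (simp add: adjugate_def)
    then show ?thesis
      using assms by (simp add: column_def)
  qed
  then show "matrix_inv A = adjugate A"
    by (simp add: inv vec_eq_iff)
qed

section \<open>Tangent spaces and curves with prescribed velocity\<close>

lemma det_mat_of_SL [simp]: "det (mat_of_SL p) = 1"
  using mat_of_SL by auto

lemma mat_of_SL_inv [simp]:
  "mat_of_SL p ** matrix_inv (mat_of_SL p) = mat 1"
  "matrix_inv (mat_of_SL p) ** mat_of_SL p = mat 1"
  by (rule matrix_inv_eq_adjugate(1,2)[OF det_mat_of_SL])+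

lemma mat_of_SL_inv_cancel [simp]:
  "mat_of_SL p ** (matrix_inv (mat_of_SL p) ** A) = A"
  "matrix_inv (mat_of_SL p) ** (mat_of_SL p ** A) = A"
  "(A ** mat_of_SL p) ** matrix_inv (mat_of_SL p) = A"
  "(A ** matrix_inv (mat_of_SL p)) ** mat_of_SL p = A"
  by (simp_all add: matrix_mul_assoc) (simp_all add: matrix_mul_assoc[symmetric])

lemma mem_tangent_iff: "u \<in> tangent p \<longleftrightarrow> trace (matrix_inv (mat_of_SL p) ** u) = 0"
  by (auto simp: tangent_def sl_def image_iff intro!: exI[of _ "matrix_inv (mat_of_SL p) ** u"])

lemma tangent_add: "u \<in> tangent p \<Longrightarrow> w \<in> tangent p \<Longrightarrow> u + w \<in> tangent p"
  by (simp add: mem_tangent_iff matrix_mult.add_right trace_add)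

lemma tangent_scaleR: "u \<in> tangent p \<Longrightarrow> c *\<^sub>R u \<in> tangent p"
  by (simp add: mem_tangent_iff matrix_mult.scaleR_right linear_cmul[OF linear_trace])

text \<open>In the Leibniz formula a permutation other than the identity moves at least two points,
  so removing one factor still leaves an off-diagonal entry of \<open>mat 1\<close>. Only the
  identity contributes.\<close>

lemma has_real_derivative_det_one:
  fixes Z :: "real^'n^'n"
  shows "((\<lambda>t. det (mat 1 + t *\<^sub>R Z)) has_real_derivative trace Z) (at 0)"
proof -
  let ?m = "mat 1 :: real^'n^'n"
  have "((\<lambda>t. det (mat 1 + t *\<^sub>R Z)) has_real_derivative
    (\<Sum>s | s permutes (UNIV::'n set). of_int (sign s) * (\<Sum>i\<in>UNIV. Z $ i $ s i * (\<Prod>j\<in>UNIV - {i}. ?m $ j $ s j)))) (at 0)"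
    unfolding det_def
  proof (intro DERIV_sum DERIV_cmult)
    fix s :: "'n \<Rightarrow> 'n"
    have "((\<lambda>t. \<Prod>i\<in>UNIV. (mat 1 + t *\<^sub>R Z) $ i $ s i) has_real_derivative
      (\<Sum>i\<in>UNIV. Z $ i $ s i * (\<Prod>j\<in>UNIV - {i}. (mat 1 + 0 *\<^sub>R Z) $ j $ s j))) (at 0)"
      by (rule has_field_derivative_prod) (auto intro!: derivative_eq_intros)
    then show "((\<lambda>t. \<Prod>i\<in>UNIV. (mat 1 + t *\<^sub>R Z) $ i $ s i) has_real_derivative
      (\<Sum>i\<in>UNIV. Z $ i $ s i * (\<Prod>j\<in>UNIV - {i}. ?m $ j $ s j))) (at 0)"
      by simp
  qed
  moreover have "(\<Sum>i\<in>UNIV. Z $ i $ s i * (\<Prod>j\<in>UNIV - {i}. ?m $ j $ s j)) = 0"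
    if s: "s permutes (UNIV::'n set)" "s \<noteq> id" for s
  proof (intro sum.neutral ballI)
    fix i :: 'n
    obtain k where k: "s k \<noteq> k"
      using s(2) by (auto simp: fun_eq_iff)
    then have "s (s k) \<noteq> s k"
      using permutes_inj[OF s(1)] by (auto dest: injD)
    with k obtain j where "j \<noteq> i" "s j \<noteq> j" by metis
    then have "(\<Prod>j\<in>UNIV - {i}. ?m $ j $ s j) = 0"
      by (intro prod_zero bexI[of _ j]) (auto simp: mat_def)
    then show "Z $ i $ s i * (\<Prod>j\<in>UNIV - {i}. ?m $ j $ s j) = 0" by simp
  qed
  then have "(\<Sum>s | s permutes (UNIV::'n set). of_int (sign s) * (\<Sum>i\<in>UNIV. Z $ i $ s i * (\<Prod>j\<in>UNIV - {i}. ?m $ j $ s j)))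
    = (\<Sum>s\<in>{id}. of_int (sign s) * (\<Sum>i\<in>UNIV. Z $ i $ s i * (\<Prod>j\<in>UNIV - {i}. ?m $ j $ s j)))"
    by (intro sum.mono_neutral_right) (auto simp: permutes_id)
  moreover have "\<dots> = trace Z"
    by (simp add: trace_def mat_def sign_id)
  ultimately show ?thesis by simp
qed

text \<open>The line \<open>mat 1 + t *\<^sub>R Z\<close> leaves the group, so one of its rows is
  divided by the determinant. Since \<open>trace Z = 0\<close>, the determinant is stationary at 0
  and this correction does not change the velocity.\<close>

lemma tangent_imp_curve:
  assumes "u \<in> tangent p"
  obtains c where "c 0 = p" "((\<lambda>t. mat_of_SL (c t)) has_vector_derivative u) (at 0)"
proof -
  define Z where "Z = matrix_inv (mat_of_SL p) ** u"
  have u: "u = mat_of_SL p ** Z" by (simp add: Z_def)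
  have Z: "trace Z = 0" using assms by (simp add: Z_def mem_tangent_iff)
  \<comment> \<open>Any row will do; this only names an element of the nonempty index type.\<close>
  obtain k :: 'a where True by simp
  define M where "M t = mat 1 + t *\<^sub>R Z" for t
  \<comment> \<open>\<open>E ** M t\<close> keeps row \<open>k\<close> of \<open>M t\<close> and
    clears the others, so \<open>N t\<close> is \<open>M t\<close> with row \<open>k\<close> divided
    by its determinant.\<close>
  define E :: "real^'a^'a" where "E = (\<chi> i j. if i = k \<and> j = k then 1 else 0)"
  define N where "N t = M t + (inverse (det (M t)) - 1) *\<^sub>R (E ** M t)" for t
  have "N t = (\<chi> i. (if i = k then inverse (det (M t)) else 1) *s (M t $ i))" for t
    by (simp add: vec_eq_iff N_def E_def matrix_matrix_mult_def if_distrib if_distribR algebra_simps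
        cong: if_cong)
  then have detN: "det (N t) = 1" if "det (M t) \<noteq> 0" for t
    using that by (simp add: det_rows_mul prod.delta)
  have dM: "((\<lambda>t. det (M t)) has_real_derivative 0) (at 0)"
    using has_real_derivative_det_one[of Z] by (simp add: M_def Z)
  have M0: "M 0 = mat 1" by (simp add: M_def)
  have "((\<lambda>t. inverse (det (M t)) - 1) has_real_derivative 0) (at 0)"
    using DERIV_diff[OF DERIV_inverse_fun[OF dM] DERIV_const[of 1]] by (simp add: M0)
  moreover have "(M has_vector_derivative Z) (at 0)"
    unfolding M_def by (auto intro!: derivative_eq_intros)
  moreover from this have "((\<lambda>t. E ** M t) has_vector_derivative E ** Z) (at 0)"
    by (rule bounded_linear.has_vector_derivative[OF matrix_mult.bounded_linear_right])
  ultimately have "(N has_vector_derivative Z) (at 0)"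
    using has_vector_derivative_add[OF _ has_vector_derivative_scaleR]
    unfolding N_def by (fastforce simp: M0)
  then have dN: "((\<lambda>t. mat_of_SL p ** N t) has_vector_derivative u) (at 0)"
    unfolding u by (rule bounded_linear.has_vector_derivative[OF matrix_mult.bounded_linear_right])
  \<comment> \<open>The value \<open>p\<close> is a placeholder where the determinant vanishes,
    which does not happen near 0.\<close>
  define c where "c t = (if det (M t) = 0 then p else SL_of_mat (mat_of_SL p ** N t))" for t
  have "mat_of_SL (c t) = mat_of_SL p ** N t" if "det (M t) \<noteq> 0" for t
    using that detN by (simp add: c_def SL_of_mat_inverse det_mul)
  moreover have "\<forall>\<^sub>F t in at 0. det (M t) \<noteq> 0"
    using DERIV_isCont[OF dM] by (intro tendsto_imp_eventually_ne) (auto simp: isCont_def M0)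
  ultimately have "\<forall>\<^sub>F t in at 0. mat_of_SL p ** N t = mat_of_SL (c t)"
    by (auto elim: eventually_mono)
  moreover have c0: "c 0 = p"
    using M0 by (simp add: c_def N_def mat_of_SL_inverse)
  ultimately have "((\<lambda>t. mat_of_SL (c t)) has_vector_derivative u) (at 0)"
    using has_derivative_transform_eventually[OF dN[unfolded has_vector_derivative_def]]
    by (simp add: has_vector_derivative_def N_def M0)
  with c0 show ?thesis by (rule that)
qed


section \<open>Differentials of smooth maps on the group\<close>

text \<open>A product rule: the first summand differentiates the moving direction, the second is the
  Hessian of \<open>F\<close> in coordinates, the part that cancels in commutators.\<close>

lemma has_derivative_frechet_along:
  fixes F :: "'a::euclidean_space \<Rightarrow> 'b::real_normed_vector"
  assumes "open U" "x \<in> U" "Ck_on 2 U F" "Ck_on 1 U G"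
  shows "((\<lambda>z. frechet_derivative F (at z) (G z)) has_derivative
    (\<lambda>u. frechet_derivative F (at x) (frechet_derivative G (at x) u)
      + (\<Sum>b\<in>Basis. (G x \<bullet> b) *\<^sub>R frechet_derivative (\<lambda>z. frechet_derivative F (at z) b) (at x) u))) (at x)"
proof -
  have F1: "Ck_on (Suc 0) U F" and F2: "\<And>b. Ck_on (Suc 0) U (\<lambda>z. frechet_derivative F (at z) b)"
    using assms(3) by (auto simp: numeral_2_eq_2 intro: differentiable_imp_continuous_on)
  have G: "Ck_on (Suc 0) U G" using assms(4) by simp
  have "((\<lambda>z. \<Sum>b\<in>Basis. (G z \<bullet> b) *\<^sub>R frechet_derivative F (at z) b) has_derivative
    (\<lambda>u. \<Sum>b\<in>Basis. (G x \<bullet> b) *\<^sub>R frechet_derivative (\<lambda>z. frechet_derivative F (at z) b) (at x) u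
       + (frechet_derivative G (at x) u \<bullet> b) *\<^sub>R frechet_derivative F (at x) b)) (at x)"
    by (intro has_derivative_sum has_derivative_scaleR has_derivative_inner_left
        Ck_on_Suc_has_derivative[OF assms(1,2), where k = 0] F2 G)
  then have "((\<lambda>z. frechet_derivative F (at z) (G z)) has_derivative
    (\<lambda>u. \<Sum>b\<in>Basis. (G x \<bullet> b) *\<^sub>R frechet_derivative (\<lambda>z. frechet_derivative F (at z) b) (at x) u
       + (frechet_derivative G (at x) u \<bullet> b) *\<^sub>R frechet_derivative F (at x) b)) (at x)"
    by (rule has_derivative_transform_within_open[OF _ assms(1,2)])
       (rule frechet_derivative_expand_Basis[OF assms(1) _ F1, symmetric])
  then show ?thesis
    by (simp only: sum.distrib frechet_derivative_expand_Basis[OF assms(1,2) F1, symmetric]) (simp add: add.commute)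
qed

text \<open>Both sides are the Hessian with one argument in coordinates; expanding the other
  argument too reduces the claim to \<open>frechet_derivative_commute\<close> on basis
  vectors.\<close>

lemma second_derivative_symmetric:
  fixes F :: "'a::euclidean_space \<Rightarrow> real"
  assumes "open U" "x \<in> U" "Ck_on 2 U F"
  shows "(\<Sum>b\<in>Basis. (w \<bullet> b) *\<^sub>R frechet_derivative (\<lambda>z. frechet_derivative F (at z) b) (at x) u)
    = (\<Sum>b\<in>Basis. (u \<bullet> b) *\<^sub>R frechet_derivative (\<lambda>z. frechet_derivative F (at z) b) (at x) w)"
proof -
  let ?H = "\<lambda>b. frechet_derivative (\<lambda>z. frechet_derivative F (at z) b) (at x)"
  have F2: "Ck_on (Suc 0) U (\<lambda>z. frechet_derivative F (at z) b)" for b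
    using assms(3) by (auto simp: numeral_2_eq_2 intro: differentiable_imp_continuous_on)
  have H: "?H b v = (\<Sum>c\<in>Basis. (v \<bullet> c) *\<^sub>R ?H b c)" for b v
    by (rule frechet_derivative_expand_Basis[OF assms(1,2) F2])
  have "(\<Sum>b\<in>Basis. (w \<bullet> b) *\<^sub>R ?H b u) = (\<Sum>b\<in>Basis. \<Sum>c\<in>Basis. (w \<bullet> b) * (u \<bullet> c) * ?H b c)"
    by (subst H) (simp add: sum_distrib_left mult.assoc)
  also have "\<dots> = (\<Sum>b\<in>Basis. \<Sum>c\<in>Basis. (w \<bullet> b) * (u \<bullet> c) * ?H c b)"
    using frechet_derivative_commute[OF assms] by simp
  also have "\<dots> = (\<Sum>c\<in>Basis. \<Sum>b\<in>Basis. (w \<bullet> b) * (u \<bullet> c) * ?H c b)"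
    by (rule sum.swap)
  also have "\<dots> = (\<Sum>c\<in>Basis. (u \<bullet> c) *\<^sub>R ?H c w)"
    by (subst (2) H) (simp add: sum_distrib_left mult_ac)
  finally show ?thesis .
qed

text \<open>Names the witness inside \<open>smooth\<close>, so that several maps can share one
  domain and derivatives on the group can be computed as ambient ones.\<close>

definition local_extension ::
    "('n::finite SL \<Rightarrow> 'b::real_normed_vector) \<Rightarrow> (real^'n^'n) set \<Rightarrow> (real^'n^'n \<Rightarrow> 'b) \<Rightarrow> bool"
  where "local_extension f U F \<longleftrightarrow>
    open U \<and> (\<forall>k. Ck_on k U F) \<and> (\<forall>q. mat_of_SL q \<in> U \<longrightarrow> F (mat_of_SL q) = f q)"

lemma smooth_iff_local_extension:
  "smooth f \<longleftrightarrow> (\<forall>p. \<exists>U F. mat_of_SL p \<in> U \<and> local_extension f U F)"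
  unfolding smooth_def local_extension_def by meson

lemma local_extension_subset:
  "local_extension f U F \<Longrightarrow> open V \<Longrightarrow> V \<subseteq> U \<Longrightarrow> local_extension f V F"
  unfolding local_extension_def by (auto intro: Ck_on_subset)

lemma smooth_local_extensions:
  assumes "smooth f" "smooth g"
  obtains U F G where "mat_of_SL p \<in> U" "local_extension f U F" "local_extension g U G"
proof -
  obtain U F where U: "mat_of_SL p \<in> U" "local_extension f U F"
    using assms(1) unfolding smooth_iff_local_extension by blast
  obtain V G where V: "mat_of_SL p \<in> V" "local_extension g V G"
    using assms(2) unfolding smooth_iff_local_extension by blast
  have "open (U \<inter> V)"
    using U V by (auto simp: local_extension_def)
  then show ?thesis
    using U V by (intro that[of "U \<inter> V" F G]) (auto elim: local_extension_subset)
qed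

lemma smooth_bilinear:
  assumes "bounded_bilinear h" "smooth f" "smooth g"
  shows "smooth (\<lambda>p. h (f p) (g p))"
  unfolding smooth_iff_local_extension
proof
  fix p
  obtain U F G where "mat_of_SL p \<in> U" "local_extension f U F" "local_extension g U G"
    by (rule smooth_local_extensions[OF assms(2,3)])
  then show "\<exists>U F. mat_of_SL p \<in> U \<and> local_extension (\<lambda>p. h (f p) (g p)) U F"
    by (intro exI[of _ U] exI[of _ "\<lambda>x. h (F x) (G x)"])
       (simp add: local_extension_def Ck_on_bilinear[OF assms(1)])
qed

lemma smooth_add:
  assumes "smooth f" "smooth g"
  shows "smooth (\<lambda>p. f p + g p)"
  unfolding smooth_iff_local_extension
proof
  fix p
  obtain U F G where "mat_of_SL p \<in> U" "local_extension f U F" "local_extension g U G"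
    by (rule smooth_local_extensions[OF assms])
  then show "\<exists>U F. mat_of_SL p \<in> U \<and> local_extension (\<lambda>p. f p + g p) U F"
    by (intro exI[of _ U] exI[of _ "\<lambda>x. F x + G x"]) (simp add: local_extension_def Ck_on_add)
qed

lemma smooth_bounded_linear:
  assumes "bounded_linear h" "smooth f"
  shows "smooth (\<lambda>p. h (f p))"
  unfolding smooth_iff_local_extension
proof
  fix p
  obtain U F where "mat_of_SL p \<in> U" "local_extension f U F"
    using assms(2) unfolding smooth_iff_local_extension by blast
  then show "\<exists>U F. mat_of_SL p \<in> U \<and> local_extension (\<lambda>p. h (f p)) U F"
    by (intro exI[of _ U] exI[of _ "\<lambda>x. h (F x)"])
       (simp add: local_extension_def Ck_on_compose_bounded_linear[OF assms(1)])
qed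

lemma smooth_restrict:
  assumes "\<And>k. Ck_on k UNIV F"
  shows "smooth (\<lambda>p. F (mat_of_SL p))"
  unfolding smooth_iff_local_extension
  by (intro allI exI[of _ UNIV] exI[of _ F]) (simp add: local_extension_def assms)

lemma smooth_const: "smooth (\<lambda>p. c)"
  using smooth_restrict[of "\<lambda>x. c"] by (simp add: Ck_on_const)

lemma smooth_mat_of_SL: "smooth mat_of_SL"
  using smooth_restrict[of "\<lambda>x. x"] by (simp add: Ck_on_bounded_linear bounded_linear_ident)

lemma smooth_inv: "smooth (\<lambda>p. matrix_inv (mat_of_SL p))"
  using smooth_restrict[of adjugate] by (simp add: Ck_on_adjugate matrix_inv_eq_adjugate(3))

lemma smooth_matrix_mult:
  fixes f :: "'n::finite SL \<Rightarrow> real^'m^'k" and g :: "'n SL \<Rightarrow> real^'l^'m"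
  shows "smooth f \<Longrightarrow> smooth g \<Longrightarrow> smooth (\<lambda>p. f p ** g p)"
  by (rule smooth_bilinear[OF bounded_bilinear_matrix_mult])

lemma smooth_scaleR: "smooth f \<Longrightarrow> smooth g \<Longrightarrow> smooth (\<lambda>p. f p *\<^sub>R g p)"
  by (rule smooth_bilinear[OF bounded_bilinear_scaleR])

lemma smooth_minus: "smooth f \<Longrightarrow> smooth (\<lambda>p. - f p)"
  by (rule smooth_bounded_linear[OF bounded_linear_minus[OF bounded_linear_ident]])

lemma smooth_diff:
  assumes "smooth f" "smooth g"
  shows "smooth (\<lambda>p. f p - g p)"
  using smooth_add[OF assms(1) smooth_minus[OF assms(2)]] by simp

text \<open>The condition under the \<open>THE\<close> of \<open>differential\<close>, with values
  in a normed space: vector fields have to be differentiated too, as matrix-valued maps.\<close>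

definition curve_deriv ::
    "('n::finite SL \<Rightarrow> 'b::real_normed_vector) \<Rightarrow> 'n SL \<Rightarrow> real^'n^'n \<Rightarrow> 'b \<Rightarrow> bool"
  where "curve_deriv f p u d \<longleftrightarrow>
    (\<forall>c. c 0 = p \<and> ((\<lambda>t. mat_of_SL (c t)) has_vector_derivative u) (at 0)
       \<longrightarrow> ((\<lambda>t. f (c t)) has_vector_derivative d) (at 0))"

definition vdiff ::
    "('n::finite SL \<Rightarrow> 'b::real_normed_vector) \<Rightarrow> 'n SL \<Rightarrow> real^'n^'n \<Rightarrow> 'b"
  where "vdiff f p u = (THE d. curve_deriv f p u d)"

lemma differential_eq_vdiff: "differential f p u = vdiff f p u"
  by (simp add: differential_def vdiff_def curve_deriv_def has_real_derivative_iff_has_vector_derivative)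

lemma vdiff_eqI:
  assumes "u \<in> tangent p" "curve_deriv f p u d"
  shows "vdiff f p u = d"
  unfolding vdiff_def
proof (rule the_equality)
  \<comment> \<open>Without a curve of velocity \<open>u\<close> every \<open>d'\<close> would
    satisfy \<open>curve_deriv\<close> vacuously; this is where tangency of \<open>u\<close>
    enters.\<close>
  obtain c where c: "c 0 = p" "((\<lambda>t. mat_of_SL (c t)) has_vector_derivative u) (at 0)"
    by (rule tangent_imp_curve[OF assms(1)])
  show "d' = d" if "curve_deriv f p u d'" for d'
    using c that assms(2) unfolding curve_deriv_def by (blast intro: vector_derivative_unique_at)
qed (rule assms(2))

text \<open>The chain rule applies to \<open>F\<close> along the curve. By continuity the curve
  stays in the open set \<open>U\<close> near 0, where \<open>F\<close> and \<open>f\<close> agree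
  on the group.\<close>

lemma curve_deriv_local_extension:
  assumes "local_extension f U F" "mat_of_SL p \<in> U"
  shows "curve_deriv f p u (frechet_derivative F (at (mat_of_SL p)) u)"
  unfolding curve_deriv_def
proof (intro allI impI, elim conjE)
  fix c assume c: "c 0 = p" "((\<lambda>t. mat_of_SL (c t)) has_vector_derivative u) (at 0)"
  have U: "open U" "Ck_on (Suc 0) U F" and F: "mat_of_SL q \<in> U \<Longrightarrow> F (mat_of_SL q) = f q" for q
    using assms(1) unfolding local_extension_def by blast+
  have "(F has_derivative frechet_derivative F (at (mat_of_SL p))) (at (mat_of_SL (c 0)))"
    unfolding c(1) by (rule Ck_on_Suc_has_derivative[OF U(1) assms(2) U(2)])
  from has_derivative_along_curve[OF this c(2)]
  have der: "((\<lambda>t. F (mat_of_SL (c t))) has_vector_derivative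
      frechet_derivative F (at (mat_of_SL p)) u) (at 0)" .
  have "isCont (\<lambda>t. mat_of_SL (c t)) 0"
    using c(2) by (rule has_vector_derivative_continuous)
  then have "\<forall>\<^sub>F t in at 0. mat_of_SL (c t) \<in> U"
    using assms(2) U(1) c(1) by (auto simp: isCont_def intro: topological_tendstoD)
  then have "\<forall>\<^sub>F t in at 0. F (mat_of_SL (c t)) = f (c t)"
    by (rule eventually_mono) (rule F)
  then show "((\<lambda>t. f (c t)) has_vector_derivative frechet_derivative F (at (mat_of_SL p)) u) (at 0)"
    using has_derivative_transform_eventually[OF der[unfolded has_vector_derivative_def]] F assms(2) c(1)
    by (simp add: has_vector_derivative_def)
qed

lemma vdiff_local_extension:
  assumes "local_extension f U F" "mat_of_SL p \<in> U" "u \<in> tangent p"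
  shows "vdiff f p u = frechet_derivative F (at (mat_of_SL p)) u"
  by (rule vdiff_eqI[OF assms(3) curve_deriv_local_extension[OF assms(1,2)]])

lemma curve_deriv_vdiff:
  assumes "smooth f" "u \<in> tangent p"
  shows "curve_deriv f p u (vdiff f p u)"
  using assms vdiff_local_extension curve_deriv_local_extension unfolding smooth_iff_local_extension
  by metis

lemma local_extension_linear:
  assumes "local_extension f U F" "x \<in> U"
  shows "linear (frechet_derivative F (at x))"
  using assms has_derivative_linear[OF Ck_on_Suc_has_derivative[of U x 0 F]]
  unfolding local_extension_def by blast

lemma vdiff_add_direction:
  assumes "smooth f" "u \<in> tangent p" "w \<in> tangent p"
  shows "vdiff f p (u + w) = vdiff f p u + vdiff f p w"
proof -
  obtain U F where "mat_of_SL p \<in> U" "local_extension f U F"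
    using assms(1) unfolding smooth_iff_local_extension by blast
  then show ?thesis
    using assms by (simp add: vdiff_local_extension tangent_add linear_add[OF local_extension_linear])
qed

lemma vdiff_scaleR_direction:
  assumes "smooth f" "u \<in> tangent p"
  shows "vdiff f p (c *\<^sub>R u) = c *\<^sub>R vdiff f p u"
proof -
  obtain U F where "mat_of_SL p \<in> U" "local_extension f U F"
    using assms(1) unfolding smooth_iff_local_extension by blast
  then show ?thesis
    using assms by (simp add: vdiff_local_extension tangent_scaleR linear_cmul[OF local_extension_linear])
qed

lemma vdiff_const: "u \<in> tangent p \<Longrightarrow> vdiff (\<lambda>q. c) p u = 0"
  by (rule vdiff_eqI) (auto simp: curve_deriv_def)

lemma vdiff_mat_of_SL: "u \<in> tangent p \<Longrightarrow> vdiff mat_of_SL p u = u"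
  by (rule vdiff_eqI) (auto simp: curve_deriv_def)

lemma vdiff_add:
  assumes "smooth f" "smooth g" "u \<in> tangent p"
  shows "vdiff (\<lambda>q. f q + g q) p u = vdiff f p u + vdiff g p u"
  using curve_deriv_vdiff[OF assms(1,3)] curve_deriv_vdiff[OF assms(2,3)]
  by (intro vdiff_eqI[OF assms(3)]) (auto simp: curve_deriv_def intro!: has_vector_derivative_add)

lemma vdiff_bounded_linear:
  assumes "bounded_linear h" "smooth f" "u \<in> tangent p"
  shows "vdiff (\<lambda>q. h (f q)) p u = h (vdiff f p u)"
  using curve_deriv_vdiff[OF assms(2,3)]
  by (intro vdiff_eqI[OF assms(3)])
     (auto simp: curve_deriv_def intro!: bounded_linear.has_vector_derivative[OF assms(1)])

lemma vdiff_bilinear: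
  assumes "bounded_bilinear h" "smooth f" "smooth g" "u \<in> tangent p"
  shows "vdiff (\<lambda>q. h (f q) (g q)) p u = h (f p) (vdiff g p u) + h (vdiff f p u) (g p)"
proof (rule vdiff_eqI[OF assms(4)], unfold curve_deriv_def, intro allI impI)
  fix c assume c: "c 0 = p \<and> ((\<lambda>t. mat_of_SL (c t)) has_vector_derivative u) (at 0)"
  then have "((\<lambda>t. f (c t)) has_vector_derivative vdiff f p u) (at 0)"
    "((\<lambda>t. g (c t)) has_vector_derivative vdiff g p u) (at 0)"
    using curve_deriv_vdiff[OF assms(2,4)] curve_deriv_vdiff[OF assms(3,4)]
    unfolding curve_deriv_def by blast+
  from bounded_bilinear.has_vector_derivative[OF assms(1) this]
  show "((\<lambda>t. h (f (c t)) (g (c t))) has_vector_derivative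
      h (f p) (vdiff g p u) + h (vdiff f p u) (g p)) (at 0)"
    using c by simp
qed

lemmas vdiff_matrix_mult = vdiff_bilinear[OF bounded_bilinear_matrix_mult]
lemmas vdiff_scaleR = vdiff_bilinear[OF bounded_bilinear_scaleR]

text \<open>Follows by differentiating the constant p^-1 p = 1 with the product rule and solving for
  the derivative of the inverse.\<close>

lemma vdiff_inv:
  assumes "u \<in> tangent p"
  shows "vdiff (\<lambda>q. matrix_inv (mat_of_SL q)) p u
    = - (matrix_inv (mat_of_SL p) ** u ** matrix_inv (mat_of_SL p))" (is "?d = _")
proof -
  let ?i = "matrix_inv (mat_of_SL p)"
  have "?i ** u + ?d ** mat_of_SL p = 0"
    using vdiff_matrix_mult[OF smooth_inv smooth_mat_of_SL assms]
    by (simp add: vdiff_mat_of_SL[OF assms] vdiff_const[OF assms])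
  then have "?d ** mat_of_SL p = - (?i ** u)"
    by (simp add: eq_neg_iff_add_eq_0 add.commute)
  then have "(?d ** mat_of_SL p) ** ?i = - (?i ** u) ** ?i" by simp
  then show ?thesis by (simp add: matrix_mult.minus_left)
qed

text \<open>The extension lives on the same \<open>U\<close>, so second derivatives along fields can
  again be taken in the ambient space.\<close>

lemma local_extension_vdiff:
  assumes "local_extension f U F" "local_extension X U G" "\<And>q. X q \<in> tangent q"
  shows "local_extension (\<lambda>q. vdiff f q (X q)) U (\<lambda>x. frechet_derivative F (at x) (G x))"
proof -
  have "frechet_derivative F (at (mat_of_SL q)) (G (mat_of_SL q)) = vdiff f q (X q)"
    if "mat_of_SL q \<in> U" for q
    using that assms(2) vdiff_local_extension[OF assms(1) that assms(3)]
    by (simp add: local_extension_def)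
  moreover have "Ck_on k U (\<lambda>x. frechet_derivative F (at x) (G x))" for k
    using assms(1,2) unfolding local_extension_def by (blast intro: Ck_on_frechet_derivative)
  ultimately show ?thesis
    using assms(1) by (simp add: local_extension_def)
qed

lemma smooth_vdiff:
  assumes "smooth f" "smooth X" "\<And>q. X q \<in> tangent q"
  shows "smooth (\<lambda>q. vdiff f q (X q))"
  unfolding smooth_iff_local_extension
proof
  fix p
  obtain U F G where "mat_of_SL p \<in> U" "local_extension f U F" "local_extension X U G"
    by (rule smooth_local_extensions[OF assms(1,2)])
  then show "\<exists>U F. mat_of_SL p \<in> U \<and> local_extension (\<lambda>q. vdiff f q (X q)) U F"
    using local_extension_vdiff[OF _ _ assms(3)] by blast
qed

text \<open>For the extensions, each iterated derivative splits by
  \<open>has_derivative_frechet_along\<close> into a first-order and a Hessian part, and the Hessian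
  parts cancel. The flat derivatives of \<open>Y\<close> and \<open>X\<close> need not be tangent
  separately; \<open>tan\<close> concerns their difference, which is the Lie bracket.\<close>

lemma vdiff_commutator:
  fixes f :: "'n::finite SL \<Rightarrow> real"
  assumes f: "smooth f" and X: "vector_field X" and Y: "vector_field Y"
    and tan: "vdiff Y p (X p) - vdiff X p (Y p) \<in> tangent p"
  shows "vdiff (\<lambda>q. vdiff f q (Y q)) p (X p) - vdiff (\<lambda>q. vdiff f q (X q)) p (Y p)
    = vdiff f p (vdiff Y p (X p) - vdiff X p (Y p))"
proof -
  have XY: "smooth X" "smooth Y" "\<And>q. X q \<in> tangent q" "\<And>q. Y q \<in> tangent q"
    using X Y by (auto simp: vector_field_def)
  obtain U F A where U: "mat_of_SL p \<in> U" "local_extension f U F" "local_extension X U A"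
    by (rule smooth_local_extensions[OF f XY(1)])
  obtain V F' B where V: "mat_of_SL p \<in> V" "local_extension f V F'" "local_extension Y V B"
    by (rule smooth_local_extensions[OF f XY(2)])
  define W where "W = U \<inter> V"
  have "open W" and p: "mat_of_SL p \<in> W"
    using U V by (auto simp: W_def local_extension_def)
  then have F: "local_extension f W F" and A: "local_extension X W A" and B: "local_extension Y W B"
    using U V by (auto simp: W_def elim: local_extension_subset)
  let ?x = "mat_of_SL p"
  let ?D = "\<lambda>F. frechet_derivative F (at ?x)"
  let ?S = "\<lambda>w u. \<Sum>b\<in>Basis. (w \<bullet> b) *\<^sub>R ?D (\<lambda>z. frechet_derivative F (at z) b) u"
  have ext: "Ck_on k W F" "Ck_on k W A" "Ck_on k W B" "A ?x = X p" "B ?x = Y p" for k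
    using F A B p by (auto simp: local_extension_def)
  note along = frechet_derivative_at[OF has_derivative_frechet_along[OF \<open>open W\<close> p ext(1)], symmetric]
  have "vdiff (\<lambda>q. vdiff f q (Y q)) p (X p) = ?D F (?D B (X p)) + ?S (Y p) (X p)"
    using vdiff_local_extension[OF local_extension_vdiff[OF F B XY(4)] p XY(3)] along[OF ext(3)]
    by (simp only: ext)
  moreover have "vdiff (\<lambda>q. vdiff f q (X q)) p (Y p) = ?D F (?D A (Y p)) + ?S (X p) (Y p)"
    using vdiff_local_extension[OF local_extension_vdiff[OF F A XY(3)] p XY(4)] along[OF ext(2)]
    by (simp only: ext)
  moreover have "?S (Y p) (X p) = ?S (X p) (Y p)"
    by (rule second_derivative_symmetric[OF \<open>open W\<close> p ext(1)])
  moreover have "vdiff f p (vdiff Y p (X p) - vdiff X p (Y p)) = ?D F (?D B (X p)) - ?D F (?D A (Y p))"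
    unfolding vdiff_local_extension[OF F p tan]
    by (simp add: vdiff_local_extension[OF B p XY(3)] vdiff_local_extension[OF A p XY(4)]
        linear_diff[OF local_extension_linear[OF F p]])
  ultimately show ?thesis by simp
qed


section \<open>The Levi-Civita connection\<close>

abbreviation inv_SL :: "'n::finite SL \<Rightarrow> real^'n^'n"
  where "inv_SL p \<equiv> matrix_inv (mat_of_SL p)"

lemma field_deriv_eq_vdiff: "field_deriv X f p = vdiff f p (X p)"
  by (simp add: field_deriv_def differential_eq_vdiff)

lemma vector_fieldD:
  assumes "vector_field X"
  shows "smooth X" "X p \<in> tangent p"
  using assms by (auto simp: vector_field_def)

lemma vector_field_left_invariant: "trace Z = 0 \<Longrightarrow> vector_field (left_invariant_field Z)"
  unfolding vector_field_def left_invariant_field_def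
  by (auto simp: mem_tangent_iff intro: smooth_matrix_mult smooth_mat_of_SL smooth_const)

lemma smooth_entry: "smooth f \<Longrightarrow> smooth (\<lambda>q. f q $ i $ j :: real)"
  by (rule smooth_bounded_linear[OF bounded_linear_matrix_entry])

lemma vdiff_entry:
  "u \<in> tangent p \<Longrightarrow> vdiff (\<lambda>q. mat_of_SL q $ i $ j) p u = u $ i $ j"
  by (simp add: vdiff_bounded_linear[OF bounded_linear_matrix_entry smooth_mat_of_SL] vdiff_mat_of_SL)

section \<open>Symmetry and nondegeneracy of the metric\<close>

lemma metric_eq: "metric p u w = - trace (inv_SL p ** u ** (inv_SL p ** w))"
  by (simp add: metric_def lie_metric_def)

lemma metric_sym: "metric p u w = metric p w u"
  by (simp add: metric_eq trace_mul_sym[of "inv_SL p ** u"])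

lemma metric_diff_left: "metric p (u - u') w = metric p u w - metric p u' w"
  by (simp add: metric_eq matrix_mult.diff_left matrix_mult.diff_right trace_sub)

text \<open>The metric is indefinite in general, so \<open>u\<close> is not tested against itself.
  For Z = p^-1 u the vector p Z^t is tangent, as transposition keeps the trace, and pairing with it
  gives minus the sum of the squared entries of Z.\<close>

lemma metric_nondegenerate:
  assumes "u \<in> tangent p" "\<And>w. w \<in> tangent p \<Longrightarrow> metric p u w = 0"
  shows "u = 0"
proof -
  let ?Z = "inv_SL p ** u"
  have "trace (transpose ?Z) = trace ?Z"
    by (simp add: trace_def transpose_def)
  then have "mat_of_SL p ** transpose ?Z \<in> tangent p"
    using assms(1) by (simp add: mem_tangent_iff)
  from assms(2)[OF this] have "trace (?Z ** transpose ?Z) = 0"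
    by (simp add: metric_eq)
  then have "(\<Sum>i\<in>UNIV. \<Sum>j\<in>UNIV. (?Z $ i $ j)\<^sup>2) = 0"
    by (simp add: trace_def matrix_matrix_mult_def transpose_def power2_eq_square)
  then have "\<forall>i j. ?Z $ i $ j = 0"
    by (simp add: sum_nonneg_eq_0_iff sum_nonneg)
  then have "?Z = 0" by (simp add: vec_eq_iff)
  then have "mat_of_SL p ** ?Z = 0" by simp
  then show ?thesis by simp
qed

text \<open>The metric is bi-invariant, so in the left trivialisation \<open>X = p \<xi>\<close>, \<open>Y = p \<eta>\<close> the connection is
  \<open>d\<eta>(X) + [\<xi>, \<eta>] / 2\<close>. Rewritten in terms of matrix fields this is the following formula.\<close>

definition lc_connection ::
    "('n::finite SL \<Rightarrow> real^'n^'n) \<Rightarrow> ('n SL \<Rightarrow> real^'n^'n) \<Rightarrow> ('n SL \<Rightarrow> real^'n^'n)"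
  where "lc_connection X Y p =
    vdiff Y p (X p) - (1/2) *\<^sub>R (X p ** inv_SL p ** Y p + Y p ** inv_SL p ** X p)"

lemma vdiff_left_trivialisation:
  assumes "smooth Y" "u \<in> tangent p"
  shows "vdiff (\<lambda>q. inv_SL q ** Y q) p u = inv_SL p ** vdiff Y p u - inv_SL p ** u ** (inv_SL p ** Y p)"
  using vdiff_matrix_mult[OF smooth_inv assms]
  by (simp add: vdiff_inv[OF assms(2)] matrix_mult.minus_left matrix_mul_assoc)

text \<open>Comes from differentiating the constant trace(p^-1 Y) = 0. The value is the failure of
  the flat derivative to be tangent, which the symmetric term in \<open>lc_connection\<close>
  removes.\<close>

lemma trace_vdiff_vector_field:
  assumes "vector_field Y" "u \<in> tangent p"
  shows "trace (inv_SL p ** vdiff Y p u) = trace (inv_SL p ** u ** (inv_SL p ** Y p))"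
proof -
  note Y = vector_fieldD[OF assms(1)]
  have "trace (vdiff (\<lambda>q. inv_SL q ** Y q) p u) = vdiff (\<lambda>q. trace (inv_SL q ** Y q)) p u"
    by (rule vdiff_bounded_linear[OF bounded_linear_trace _ assms(2), symmetric])
       (intro smooth_matrix_mult smooth_inv Y)
  also have "\<dots> = 0"
    using Y(2) by (simp add: mem_tangent_iff vdiff_const[OF assms(2)])
  finally show ?thesis
    by (simp add: vdiff_left_trivialisation[OF Y(1) assms(2)] trace_sub)
qed

lemma left_trivialisation_lc_connection:
  "inv_SL p ** lc_connection X Y p = inv_SL p ** vdiff Y p (X p)
    - (1/2) *\<^sub>R (inv_SL p ** X p ** (inv_SL p ** Y p) + inv_SL p ** Y p ** (inv_SL p ** X p))"
  by (simp add: lc_connection_def matrix_mult.diff_right matrix_mult.scaleR_right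
      matrix_mult.add_right matrix_mul_assoc)

lemma vector_field_lc_connection:
  assumes X: "vector_field X" and Y: "vector_field Y"
  shows "vector_field (lc_connection X Y)"
proof -
  note X' = vector_fieldD[OF X] and Y' = vector_fieldD[OF Y]
  have "smooth (lc_connection X Y)"
    unfolding lc_connection_def
    by (intro smooth_diff smooth_add smooth_vdiff smooth_scaleR smooth_const smooth_matrix_mult
        smooth_inv X' Y')
  moreover have "lc_connection X Y p \<in> tangent p" for p
    by (simp add: mem_tangent_iff left_trivialisation_lc_connection trace_sub trace_add
        linear_cmul[OF linear_trace] trace_vdiff_vector_field[OF Y X'(2)]
        trace_mul_sym[of "inv_SL p ** Y p"])
  ultimately show ?thesis by (simp add: vector_field_def)
qed

lemma lc_connection_metric:
  assumes X: "vector_field X" and Y: "vector_field Y" and Z: "vector_field Z"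
  shows "vdiff (\<lambda>q. metric q (Y q) (Z q)) p (X p)
    = metric p (lc_connection X Y p) (Z p) + metric p (Y p) (lc_connection X Z p)"
proof -
  note X' = vector_fieldD[OF X] and Y' = vector_fieldD[OF Y] and Z' = vector_fieldD[OF Z]
  define \<xi> \<eta> \<zeta> where "\<xi> = inv_SL p ** X p" and "\<eta> = inv_SL p ** Y p" and "\<zeta> = inv_SL p ** Z p"
  define A B where "A = inv_SL p ** vdiff Y p (X p)" and "B = inv_SL p ** vdiff Z p (X p)"
  note defs = \<xi>_def[symmetric] \<eta>_def[symmetric] \<zeta>_def[symmetric] A_def[symmetric] B_def[symmetric]
  have smooth: "smooth (\<lambda>q. inv_SL q ** Y q)" "smooth (\<lambda>q. inv_SL q ** Z q)"
    by (intro smooth_matrix_mult smooth_inv X' Y' Z')+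
  have "bounded_linear (\<lambda>A :: real^'a^'a. - trace A)"
    by (rule bounded_linear_minus[OF bounded_linear_trace])
  from vdiff_bounded_linear[OF this smooth_matrix_mult[OF smooth] X'(2)]
  have "vdiff (\<lambda>q. metric q (Y q) (Z q)) p (X p)
      = - trace (vdiff (\<lambda>q. inv_SL q ** Y q ** (inv_SL q ** Z q)) p (X p))"
    by (simp add: metric_eq)
  also have "vdiff (\<lambda>q. inv_SL q ** Y q ** (inv_SL q ** Z q)) p (X p) = \<eta> ** (B - \<xi> ** \<zeta>) + (A - \<xi> ** \<eta>) ** \<zeta>"
    using vdiff_matrix_mult[OF smooth X'(2)]
    by (simp only: vdiff_left_trivialisation[OF Y'(1) X'(2)] vdiff_left_trivialisation[OF Z'(1) X'(2)] defs)
  \<comment> \<open>On both sides the cubic terms reduce to trace(\<xi>\<eta>\<zeta>) +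
    trace(\<eta>\<xi>\<zeta>), once trace(\<eta>\<zeta>\<xi>) is rotated cyclically.\<close>
  also have "- trace \<dots> = - trace ((A - (1/2) *\<^sub>R (\<xi> ** \<eta> + \<eta> ** \<xi>)) ** \<zeta>)
      - trace (\<eta> ** (B - (1/2) *\<^sub>R (\<xi> ** \<zeta> + \<zeta> ** \<xi>)))"
  proof -
    have "trace (\<eta> ** \<zeta> ** \<xi>) = trace (\<xi> ** \<eta> ** \<zeta>)"
      by (simp add: trace_mul_sym[of "\<eta> ** \<zeta>"] matrix_mul_assoc)
    then show ?thesis
      by (simp add: matrix_mult.diff_left matrix_mult.diff_right matrix_mult.add_left matrix_mult.add_right
          matrix_mult.scaleR_left matrix_mult.scaleR_right trace_add trace_sub
          linear_cmul[OF linear_trace] matrix_mul_assoc) (simp add: field_simps)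
  qed
  also have "\<dots> = metric p (lc_connection X Y p) (Z p) + metric p (Y p) (lc_connection X Z p)"
    by (simp add: metric_eq left_trivialisation_lc_connection defs)
  finally show ?thesis .
qed

text \<open>The correction term of \<open>lc_connection\<close> is symmetric in the two fields, so
  only the flat commutator survives; it is tangent because both connection terms are.\<close>

lemma lc_connection_torsion:
  fixes f :: "'n::finite SL \<Rightarrow> real"
  assumes f: "smooth f" and X: "vector_field X" and Y: "vector_field Y"
  shows "vdiff f p (lc_connection X Y p) - vdiff f p (lc_connection Y X p)
    = vdiff (\<lambda>q. vdiff f q (Y q)) p (X p) - vdiff (\<lambda>q. vdiff f q (X q)) p (Y p)"
proof -
  have tan: "lc_connection X Y p \<in> tangent p" "lc_connection Y X p \<in> tangent p"
    using vector_field_lc_connection X Y vector_fieldD(2) by blast+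
  \<comment> \<open>The factor -1 casts the difference as a sum, to fit \<open>tangent_add\<close>
    and \<open>vdiff_add_direction\<close>.\<close>
  have eq: "lc_connection X Y p + (-1) *\<^sub>R lc_connection Y X p = vdiff Y p (X p) - vdiff X p (Y p)"
    by (simp add: lc_connection_def add.commute)
  then have "vdiff Y p (X p) - vdiff X p (Y p) \<in> tangent p"
    using tangent_add[OF tan(1) tangent_scaleR[OF tan(2), of "-1"]] by simp
  from vdiff_commutator[OF f X Y this] show ?thesis
    using vdiff_add_direction[OF f tan(1) tangent_scaleR[OF tan(2), of "-1"]]
    unfolding eq by (simp only: vdiff_scaleR_direction[OF f tan(2)]) simp
qed

lemma levi_civita_lc_connection: "levi_civita lc_connection"
  unfolding levi_civita_def
proof (intro conjI allI impI)
  fix X Y X' Y' Z :: "'a SL \<Rightarrow> real^'a^'a" and f :: "'a SL \<Rightarrow> real" and p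
  assume X: "vector_field X" and Y: "vector_field Y"
  note X1 = vector_fieldD[OF X] and Y1 = vector_fieldD[OF Y]
  show "vector_field (lc_connection X Y)"
    by (rule vector_field_lc_connection[OF X Y])
  show "lc_connection (\<lambda>p. X p + X' p) Y = (\<lambda>p. lc_connection X Y p + lc_connection X' Y p)"
    if "vector_field X'"
    by (simp add: fun_eq_iff lc_connection_def vdiff_add_direction Y1 X1 vector_fieldD[OF that]
        matrix_mult.add_left matrix_mult.add_right algebra_simps)
  show "lc_connection X (\<lambda>p. Y p + Y' p) = (\<lambda>p. lc_connection X Y p + lc_connection X Y' p)"
    if "vector_field Y'"
    by (simp add: fun_eq_iff lc_connection_def vdiff_add Y1 X1 vector_fieldD[OF that]
        matrix_mult.add_left matrix_mult.add_right algebra_simps)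
  show "lc_connection (\<lambda>p. f p *\<^sub>R X p) Y = (\<lambda>p. f p *\<^sub>R lc_connection X Y p)" if "smooth f"
    by (simp add: fun_eq_iff lc_connection_def vdiff_scaleR_direction Y1 X1
        matrix_mult.scaleR_left matrix_mult.scaleR_right algebra_simps)
  show "lc_connection X (\<lambda>p. f p *\<^sub>R Y p)
      = (\<lambda>p. field_deriv X f p *\<^sub>R Y p + f p *\<^sub>R lc_connection X Y p)" if "smooth f"
    by (simp add: fun_eq_iff lc_connection_def field_deriv_eq_vdiff vdiff_scaleR[OF that Y1(1) X1(2)]
        matrix_mult.scaleR_left matrix_mult.scaleR_right algebra_simps)
  show "field_deriv (lc_connection X Y) f p - field_deriv (lc_connection Y X) f p =
      field_deriv X (field_deriv Y f) p - field_deriv Y (field_deriv X f) p" if "smooth f"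
    using lc_connection_torsion[OF that X Y] by (simp add: field_deriv_eq_vdiff[abs_def])
  show "field_deriv X (\<lambda>q. metric q (Y q) (Z q)) p =
      metric p (lc_connection X Y p) (Z p) + metric p (Y p) (lc_connection X Z p)" if "vector_field Z"
    using lc_connection_metric[OF X Y that] by (simp add: field_deriv_eq_vdiff)
qed

text \<open>The difference \<open>S\<close> of two Levi-Civita connections satisfies \<open>S X Y = S Y X\<close> and
  \<open>g (S X Y) Z = - g Y (S X Z)\<close>; alternating these two rules gives \<open>g (S X Y) Z = - g (S X Y) Z\<close>.\<close>

lemma levi_civita_unique:
  assumes D: "levi_civita D" and X: "vector_field X" and Y: "vector_field Y"
  shows "D X Y = lc_connection X Y"
proof
  fix p
  define S where "S X Y = D X Y p - lc_connection X Y p" for X Y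
  note D' = D[unfolded levi_civita_def]
  have D_field: "vector_field (D X Y)" if "vector_field X" "vector_field Y" for X Y
    using D'[THEN conjunct1] that by simp
  have torsion: "field_deriv (D X Y) f p - field_deriv (D Y X) f p =
      field_deriv X (field_deriv Y f) p - field_deriv Y (field_deriv X f) p"
    if "vector_field X" "vector_field Y" "smooth f" for X Y f
    using D'[THEN conjunct2, THEN conjunct2, THEN conjunct2, THEN conjunct2, THEN conjunct2, THEN conjunct1] that
    by simp
  have compat: "field_deriv X (\<lambda>q. metric q (Y q) (Z q)) p =
      metric p (D X Y p) (Z p) + metric p (Y p) (D X Z p)"
    if "vector_field X" "vector_field Y" "vector_field Z" for X Y Z
    using D'[THEN conjunct2, THEN conjunct2, THEN conjunct2, THEN conjunct2, THEN conjunct2, THEN conjunct2] that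
    by simp
  have tan: "D X Y p \<in> tangent p" "lc_connection X Y p \<in> tangent p"
    if "vector_field X" "vector_field Y" for X Y
    using that vector_fieldD(2) D_field vector_field_lc_connection by blast+
  have sym: "S X Y = S Y X" if X: "vector_field X" and Y: "vector_field Y" for X Y
  proof -
    have "S X Y $ i $ j = S Y X $ i $ j" for i j
    proof -
      \<comment> \<open>Torsion is stated only through derivations; coordinate functions recover the
        vector, since their differentials read off its entries.\<close>
      let ?f = "\<lambda>q. mat_of_SL q $ i $ j"
      have f: "smooth ?f" by (intro smooth_entry smooth_mat_of_SL)
      have "vdiff ?f p (D X Y p) - vdiff ?f p (D Y X p)
          = vdiff ?f p (lc_connection X Y p) - vdiff ?f p (lc_connection Y X p)"
        using torsion[OF X Y f] lc_connection_torsion[OF f X Y]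
        by (simp add: field_deriv_eq_vdiff[abs_def])
      then show ?thesis
        by (simp add: vdiff_entry tan X Y S_def)
    qed
    then show ?thesis by (simp add: vec_eq_iff)
  qed
  have skew: "metric p (S X Y) (Z p) = - metric p (S X Z) (Y p)"
    if "vector_field X" "vector_field Y" "vector_field Z" for X Y Z
    using compat[OF that] lc_connection_metric[OF that]
    by (simp add: S_def metric_diff_left metric_sym[of p "Y p"] field_deriv_eq_vdiff)
  have "S X Y = 0"
  proof (rule metric_nondegenerate)
    show "S X Y \<in> tangent p"
      using tangent_add[OF tan(1)[OF X Y] tangent_scaleR[OF tan(2)[OF X Y], of "-1"]]
      by (simp add: S_def)
    fix w assume w: "w \<in> tangent p"
    \<comment> \<open>Metric compatibility speaks of fields, so \<open>w\<close> is extended to a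
      left-invariant one.\<close>
    define Z where "Z = left_invariant_field (inv_SL p ** w)"
    have Z: "vector_field Z" and Zp: "Z p = w"
      using w by (auto simp: Z_def mem_tangent_iff left_invariant_field_def intro: vector_field_left_invariant)
    have "metric p (S X Y) (Z p) = - metric p (S Z X) (Y p)"
      using skew[OF X Y Z] sym[OF X Z] by simp
    also have "\<dots> = metric p (S Y Z) (X p)"
      using skew[OF Z X Y] sym[OF Z Y] by simp
    also have "\<dots> = - metric p (S X Y) (Z p)"
      using skew[OF Y Z X] sym[OF X Y] by simp
    finally show "metric p (S X Y) w = 0" by (simp add: Zp)
  qed
  then show "D X Y p = lc_connection X Y p" by (simp add: S_def)
qed

text \<open>Existence makes the choice in \<open>nabla\<close> a Levi-Civita connection; uniqueness
  then fixes its values on vector fields.\<close>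

lemma nabla_eq_lc_connection:
  assumes "vector_field X" "vector_field Y"
  shows "nabla X Y = lc_connection X Y"
proof -
  have "levi_civita (nabla :: ('a SL \<Rightarrow> real^'a^'a) \<Rightarrow> _)"
    unfolding nabla_def by (rule someI[of levi_civita, OF levi_civita_lc_connection])
  then show ?thesis by (rule levi_civita_unique[OF _ assms])
qed


section \<open>Gradient and divergence of linear functions of the entries\<close>

text \<open>Expanding \<open>T E\<^sub>i\<^sub>j\<close> in the basis \<open>B\<close> of \<open>S\<close> shows that the trace of \<open>T\<close> on \<open>S\<close> equals
  the trace of \<open>T\<close> on all matrices, because \<open>T\<close> maps into \<open>S\<close>.\<close>

lemma endo_trace_eq:
  fixes T :: "real^'m^'n \<Rightarrow> real^'m^'n"
  assumes S: "subspace S" and T: "linear T" "range T \<subseteq> S" and T': "\<And>u. u \<in> S \<Longrightarrow> T' u = T u"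
  shows "endo_trace S T' = (\<Sum>i\<in>UNIV. \<Sum>j\<in>UNIV. T (axis i (axis j 1)) $ i $ j)"
proof -
  define B where "B = (SOME B. independent B \<and> span B = S)"
  have "\<exists>B. independent B \<and> span B = S"
    using basis_exists[of S] S by (metis span_subspace)
  from someI_ex[OF this] have B: "independent B" "span B = S"
    by (simp_all add: B_def)
  have fin: "finite B" by (rule independent_imp_finite[OF B(1)])
  let ?r = "representation B"
  let ?E = "\<lambda>i j. axis i (axis j 1) :: real^'m^'n"
  have T_span: "T u \<in> span B" for u using T(2) B(2) by auto
  have lin: "linear (\<lambda>u. ?r (T u) b)" for b
    by (rule linearI)
       (simp_all add: linear_add[OF T(1)] linear_cmul[OF T(1)] representation_add[OF B(1)]
         representation_scale[OF B(1)] T_span)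
  have "(\<Sum>i\<in>UNIV. \<Sum>j\<in>UNIV. T (?E i j) $ i $ j)
      = (\<Sum>i\<in>UNIV. \<Sum>j\<in>UNIV. (\<Sum>b\<in>B. ?r (T (?E i j)) b *\<^sub>R b) $ i $ j)"
    by (simp add: sum_representation_eq[OF B(1) T_span fin])
  also have "\<dots> = (\<Sum>i\<in>UNIV. \<Sum>j\<in>UNIV. \<Sum>b\<in>B. b $ i $ j * ?r (T (?E i j)) b)"
    by (simp add: mult.commute)
  also have "\<dots> = (\<Sum>i\<in>UNIV. \<Sum>b\<in>B. \<Sum>j\<in>UNIV. b $ i $ j * ?r (T (?E i j)) b)"
    by (intro sum.cong refl sum.swap)
  also have "\<dots> = (\<Sum>b\<in>B. \<Sum>i\<in>UNIV. \<Sum>j\<in>UNIV. b $ i $ j * ?r (T (?E i j)) b)"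
    by (rule sum.swap)
  also have "\<dots> = (\<Sum>b\<in>B. ?r (T (\<Sum>i\<in>UNIV. \<Sum>j\<in>UNIV. b $ i $ j *\<^sub>R ?E i j)) b)"
    by (simp add: linear_sum[OF lin] linear_cmul[OF lin])
  also have "\<dots> = (\<Sum>b\<in>B. ?r (T b) b)"
    by (simp only: matrix_expand_axis[symmetric])
  also have "\<dots> = (\<Sum>b\<in>B. ?r (T' b) b)"
    using T' B(2) span_superset[of B] by (intro sum.cong refl) auto
  finally show ?thesis
    by (simp add: endo_trace_def B_def Let_def)
qed

lemma subspace_tangent: "subspace (tangent p)"
  by (rule subspaceI) (simp_all add: tangent_add tangent_scaleR, simp add: mem_tangent_iff trace_def)

definition entry_form :: "real^'n^'n \<Rightarrow> 'n::finite SL \<Rightarrow> real"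
  where "entry_form M p = trace (transpose M ** mat_of_SL p)"

text \<open>The second term alone represents the differential on tangent vectors but is in general
  not tangent. Multiples of p pair to zero with tangent vectors, and the coefficient with 1/n is the
  one that makes p^-1 times the result trace-free.\<close>

definition entry_form_gradient :: "real^'n^'n \<Rightarrow> 'n::finite SL \<Rightarrow> real^'n^'n"
  where "entry_form_gradient M p =
    (entry_form M p / CARD('n)) *\<^sub>R mat_of_SL p - mat_of_SL p ** transpose M ** mat_of_SL p"

lemma bounded_linear_trace_mult: "bounded_linear (\<lambda>x :: real^'n^'n. trace (A ** x))"
  by (rule bounded_linear_compose[OF bounded_linear_trace matrix_mult.bounded_linear_right])

lemma smooth_entry_form: "smooth (entry_form M)"
  unfolding entry_form_def[abs_def]
  by (rule smooth_bounded_linear[OF bounded_linear_trace_mult smooth_mat_of_SL])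

lemma vdiff_entry_form: "u \<in> tangent p \<Longrightarrow> vdiff (entry_form M) p u = trace (transpose M ** u)"
  unfolding entry_form_def[abs_def]
  by (simp add: vdiff_bounded_linear[OF bounded_linear_trace_mult smooth_mat_of_SL] vdiff_mat_of_SL)

lemma inv_entry_form_gradient:
  fixes p :: "'n::finite SL"
  shows "inv_SL p ** entry_form_gradient M p
    = (entry_form M p / CARD('n)) *\<^sub>R mat 1 - transpose M ** mat_of_SL p"
  by (simp add: entry_form_gradient_def matrix_mult.diff_right matrix_mult.scaleR_right
      matrix_mul_assoc[symmetric])

lemma vector_field_entry_form_gradient: "vector_field (entry_form_gradient M)"
proof -
  have "smooth (\<lambda>p. entry_form M p / CARD('a))"
    by (rule smooth_bounded_linear[OF bounded_linear_divide smooth_entry_form])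
  then have "smooth (entry_form_gradient M)"
    unfolding entry_form_gradient_def[abs_def]
    by (intro smooth_diff smooth_scaleR smooth_matrix_mult smooth_mat_of_SL smooth_const)
  moreover have "entry_form_gradient M p \<in> tangent p" for p
    by (simp add: mem_tangent_iff inv_entry_form_gradient trace_sub linear_cmul[OF linear_trace] trace_I)
       (simp add: entry_form_def)
  ultimately show ?thesis by (simp add: vector_field_def)
qed

lemma metric_entry_form_gradient:
  assumes "w \<in> tangent p"
  shows "metric p (entry_form_gradient M p) w = trace (transpose M ** w)"
  using assms
  by (simp add: metric_eq inv_entry_form_gradient matrix_mult.diff_left matrix_mult.scaleR_left
      trace_sub linear_cmul[OF linear_trace] mem_tangent_iff matrix_mul_assoc[symmetric])

lemma gradient_entry_form: "gradient (entry_form M) = entry_form_gradient M"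
proof
  fix p
  have tan: "entry_form_gradient M p \<in> tangent p"
    by (rule vector_fieldD(2)[OF vector_field_entry_form_gradient])
  have "u = entry_form_gradient M p"
    if u: "u \<in> tangent p" "\<forall>w\<in>tangent p. metric p u w = vdiff (entry_form M) p w" for u
  proof -
    have "u - entry_form_gradient M p = 0"
    proof (rule metric_nondegenerate)
      show "u - entry_form_gradient M p \<in> tangent p"
        using u(1) tan by (rule subspace_diff[OF subspace_tangent])
      show "metric p (u - entry_form_gradient M p) w = 0" if "w \<in> tangent p" for w
        using u(2) that by (simp add: metric_diff_left metric_entry_form_gradient vdiff_entry_form)
    qed
    then show ?thesis by simp
  qed
  then show "gradient (entry_form M) p = entry_form_gradient M p"
    unfolding gradient_def differential_eq_vdiff
    by (intro the_equality)
       (auto simp: tan metric_entry_form_gradient vdiff_entry_form)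
qed

lemma vdiff_entry_form_gradient:
  fixes p :: "'n::finite SL"
  assumes u: "u \<in> tangent p"
  shows "vdiff (entry_form_gradient M) p u =
    (entry_form M p / CARD('n)) *\<^sub>R u + (trace (transpose M ** u) / CARD('n)) *\<^sub>R mat_of_SL p
    - (mat_of_SL p ** transpose M ** u + u ** transpose M ** mat_of_SL p)"
proof -
  let ?c = "\<lambda>p. entry_form M p / CARD('n)" and ?Q = "\<lambda>p. mat_of_SL p ** transpose M"
  have c: "smooth ?c"
    by (rule smooth_bounded_linear[OF bounded_linear_divide smooth_entry_form])
  have dc: "vdiff ?c p u = trace (transpose M ** u) / CARD('n)"
    using vdiff_bounded_linear[OF bounded_linear_divide smooth_entry_form u] by (simp add: vdiff_entry_form[OF u])
  have Q: "smooth ?Q" by (intro smooth_matrix_mult smooth_mat_of_SL smooth_const)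
  have dQ: "vdiff ?Q p u = u ** transpose M"
    using vdiff_bounded_linear[OF matrix_mult.bounded_linear_left smooth_mat_of_SL u]
    by (simp add: vdiff_mat_of_SL[OF u])
  have QQ: "smooth (\<lambda>p. ?Q p ** mat_of_SL p)" by (intro smooth_matrix_mult Q smooth_mat_of_SL)
  have dQQ: "vdiff (\<lambda>p. ?Q p ** mat_of_SL p) p u = ?Q p ** u + u ** transpose M ** mat_of_SL p"
    using vdiff_matrix_mult[OF Q smooth_mat_of_SL u] by (simp add: dQ vdiff_mat_of_SL[OF u])
  have "vdiff (\<lambda>p. - (?Q p ** mat_of_SL p)) p u = - (?Q p ** u + u ** transpose M ** mat_of_SL p)"
    using vdiff_bounded_linear[OF bounded_linear_minus[OF bounded_linear_ident] QQ u] by (simp add: dQQ)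
  moreover have "vdiff (\<lambda>p. ?c p *\<^sub>R mat_of_SL p) p u
      = ?c p *\<^sub>R u + (trace (transpose M ** u) / CARD('n)) *\<^sub>R mat_of_SL p"
    using vdiff_scaleR[OF c smooth_mat_of_SL u] by (simp add: dc vdiff_mat_of_SL[OF u])
  ultimately show ?thesis
    using vdiff_add[OF smooth_scaleR[OF c smooth_mat_of_SL] smooth_minus[OF QQ] u]
    by (simp add: entry_form_gradient_def[abs_def])
qed

lemma nabla_at_entry_form_gradient:
  fixes p :: "'n::finite SL"
  assumes u: "u \<in> tangent p"
  shows "nabla_at p u (entry_form_gradient M) =
    (trace (transpose M ** u) / CARD('n)) *\<^sub>R mat_of_SL p
    - (1/2) *\<^sub>R (u ** transpose M ** mat_of_SL p + mat_of_SL p ** transpose M ** u)"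
proof -
  let ?X = "left_invariant_field (inv_SL p ** u)" and ?G = "entry_form_gradient M"
  have X: "vector_field ?X"
    using u by (intro vector_field_left_invariant) (simp add: mem_tangent_iff)
  have Xp: "?X p = u" by (simp add: left_invariant_field_def)
  let ?\<tau> = "(entry_form M p / CARD('n)) *\<^sub>R u" and ?k = "(trace (transpose M ** u) / CARD('n)) *\<^sub>R mat_of_SL p"
    and ?a = "u ** transpose M ** mat_of_SL p" and ?b = "mat_of_SL p ** transpose M ** u"
  have 1: "u ** inv_SL p ** ?G p = ?\<tau> - ?a"
    by (simp add: matrix_mul_assoc[symmetric] inv_entry_form_gradient)
       (simp add: matrix_mult.diff_right matrix_mult.scaleR_right)
  have 2: "?G p ** inv_SL p ** u = ?\<tau> - ?b"
    by (simp add: entry_form_gradient_def matrix_mult.diff_left matrix_mult.scaleR_left)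
  \<comment> \<open>The two halves of \<open>?\<tau>\<close> in the correction cancel the one from
    the flat derivative; of \<open>?a\<close> and \<open>?b\<close> one half each remains.\<close>
  have "nabla_at p u ?G = ?\<tau> + ?k - (?b + ?a) - (1/2) *\<^sub>R ((?\<tau> - ?a) + (?\<tau> - ?b))"
    by (simp only: nabla_at_def nabla_eq_lc_connection[OF X vector_field_entry_form_gradient]
        lc_connection_def Xp vdiff_entry_form_gradient[OF u] 1 2)
  also have "\<dots> = ?k - (1/2) *\<^sub>R (?a + ?b)"
    by (simp add: vec_eq_iff field_simps)
  finally show ?thesis .
qed

text \<open>The double sum is the trace of left multiplication by \<open>A\<close> on n by n
  matrices, which acts separately on each of the n columns. Right multiplication acts on the rows in
  the same way.\<close>

lemma sum_axis_mult_left: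
  "(\<Sum>i\<in>UNIV. \<Sum>j\<in>(UNIV :: 'n set). ((A :: real^'n^'n) ** axis i (axis j 1)) $ i $ j) = CARD('n) * trace A"
proof -
  have "(A ** axis i (axis j 1)) $ i $ j = A $ i $ i" for i j :: 'n
    by (simp add: matrix_matrix_mult_def axis_def if_distrib[of "(*) _"] if_distrib[of "\<lambda>x. x $ _"] cong: if_cong)
  then show ?thesis by (simp add: trace_def sum_distrib_left)
qed

lemma sum_axis_mult_right:
  "(\<Sum>i\<in>(UNIV :: 'n set). \<Sum>j\<in>UNIV. (axis i (axis j 1) ** (A :: real^'n^'n)) $ i $ j) = CARD('n) * trace A"
proof -
  have "(axis i (axis j 1) ** A) $ i $ j = A $ j $ j" for i j :: 'n
    by (simp add: matrix_matrix_mult_def axis_def if_distrib[of "\<lambda>x. x * _"] if_distrib[of "\<lambda>x. x $ _"] cong: if_cong)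
  then show ?thesis by (simp add: trace_def)
qed

lemma trace_transpose_mult: "trace (transpose M ** A) = (\<Sum>i\<in>UNIV. \<Sum>j\<in>UNIV. M $ i $ j * A $ i $ j)"
  by (simp add: trace_def matrix_matrix_mult_def transpose_def) (rule sum.swap)

lemma trace_transpose_mult_axis:
  "trace (transpose (M :: real^'n^'n) ** axis i (axis j 1)) = M $ i $ j"
proof -
  have "(\<Sum>b\<in>UNIV. M $ a $ b * axis i (axis j 1) $ a $ b) = (if a = i then M $ i $ j else 0)" for a
    by (cases "a = i") (simp_all add: axis_def if_distrib[of "(*) _"] cong: if_cong)
  then show ?thesis by (simp add: trace_transpose_mult)
qed

text \<open>The constant collects three traces: the part of the covariant derivative with values in
  the multiples of p contributes f/n, and left and right multiplication contribute n f each, with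
  coefficient -1/2.\<close>

lemma divergence_entry_form_gradient:
  fixes p :: "'n::finite SL"
  shows "divergence (entry_form_gradient M) p = (1 / CARD('n) - CARD('n)) * entry_form M p"
proof -
  define T where "T u = (trace (transpose M ** u) / CARD('n)) *\<^sub>R mat_of_SL p
    - (1/2) *\<^sub>R (u ** (transpose M ** mat_of_SL p) + mat_of_SL p ** transpose M ** u)" for u
  have "linear T"
    by (rule linearI)
       (simp_all add: T_def matrix_mult.add_left matrix_mult.add_right matrix_mult.scaleR_left
         matrix_mult.scaleR_right trace_add linear_cmul[OF linear_trace],
         simp_all add: vec_eq_iff field_simps)
  moreover have "range T \<subseteq> tangent p"
  proof clarify
    fix u
    have "inv_SL p ** T u = (trace (transpose M ** u) / CARD('n)) *\<^sub>R mat 1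
        - (1/2) *\<^sub>R ((inv_SL p ** u) ** (transpose M ** mat_of_SL p) + transpose M ** u)"
      by (simp add: T_def matrix_mult.diff_right matrix_mult.scaleR_right matrix_mult.add_right
          matrix_mul_assoc[symmetric])
    \<comment> \<open>By cyclicity both multiplication terms have trace(M^t u), and their half-sum
      cancels the trace of the scalar term, n times trace(M^t u)/n.\<close>
    moreover have "trace ((inv_SL p ** u) ** (transpose M ** mat_of_SL p)) = trace (transpose M ** u)"
    proof -
      have "(transpose M ** mat_of_SL p) ** (inv_SL p ** u) = transpose M ** u"
        by (simp add: matrix_mul_assoc[symmetric])
      then show ?thesis
        using trace_mul_sym[of "inv_SL p ** u" "transpose M ** mat_of_SL p"] by simp
    qed
    ultimately show "T u \<in> tangent p"
      by (simp add: mem_tangent_iff trace_sub trace_add linear_cmul[OF linear_trace] trace_I)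
  qed
  ultimately have "divergence (entry_form_gradient M) p
      = (\<Sum>i\<in>UNIV. \<Sum>j\<in>UNIV. T (axis i (axis j 1)) $ i $ j)"
    unfolding divergence_def
  proof (rule endo_trace_eq[OF subspace_tangent])
    show "nabla_at p u (entry_form_gradient M) = T u" if "u \<in> tangent p" for u
      unfolding nabla_at_entry_form_gradient[OF that] T_def by (simp only: matrix_mul_assoc)
  qed
  also have "\<dots> = (\<Sum>i\<in>UNIV. \<Sum>j\<in>UNIV. (1 / CARD('n)) * (M $ i $ j * mat_of_SL p $ i $ j)
      - (1/2) * ((axis i (axis j 1) ** (transpose M ** mat_of_SL p)) $ i $ j
        + (mat_of_SL p ** transpose M ** axis i (axis j 1)) $ i $ j))"
    by (simp add: T_def trace_transpose_mult_axis)
  also have "\<dots> = (1 / CARD('n)) * trace (transpose M ** mat_of_SL p)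
      - (1/2) * (CARD('n) * trace (transpose M ** mat_of_SL p) + CARD('n) * trace (mat_of_SL p ** transpose M))"
    by (simp only: sum_subtractf sum.distrib sum_distrib_left[symmetric]
        sum_axis_mult_left sum_axis_mult_right trace_transpose_mult)
  also have "trace (mat_of_SL p ** transpose M) = entry_form M p"
    by (simp add: entry_form_def trace_mul_sym[of "mat_of_SL p"])
  finally show ?thesis
    by (simp add: entry_form_def[symmetric] field_simps)
qed

text \<open>The metric of two gradients is the differential of the first function applied to the
  second gradient.\<close>

lemma metric_gradients:
  fixes p :: "'n::finite SL"
  shows "metric p (entry_form_gradient M p) (entry_form_gradient N p)
    = entry_form M p * entry_form N p / CARD('n)
      - trace (transpose M ** mat_of_SL p ** (transpose N ** mat_of_SL p))"
  by (subst metric_entry_form_gradient[OF vector_fieldD(2)[OF vector_field_entry_form_gradient]])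
     (simp add: entry_form_gradient_def matrix_mult.diff_right matrix_mult.scaleR_right trace_sub
       linear_cmul[OF linear_trace] entry_form_def[of M] matrix_mul_assoc)


section \<open>The eigenfamily\<close>

lemma phi_eq: "phi v a x = (\<Sum>i\<in>UNIV. \<Sum>j\<in>UNIV. v $ i * a $ j * of_real (mat_of_SL x $ i $ j))"
  by (simp add: phi_def row_outer_def trace_def matrix_matrix_mult_def transpose_def)

lemma Re_phi: "(\<lambda>x. Re (phi v a x)) = entry_form (map_matrix Re (row_outer v a))"
  by (simp add: fun_eq_iff phi_eq entry_form_def trace_transpose_mult row_outer_def)

lemma Im_phi: "(\<lambda>x. Im (phi v a x)) = entry_form (map_matrix Im (row_outer v a))"
  by (simp add: fun_eq_iff phi_eq entry_form_def trace_transpose_mult row_outer_def)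

lemma map_matrix_complex_gradient:
  "map_matrix Re (complex_gradient \<phi> p) = gradient (\<lambda>q. Re (\<phi> q)) p"
  "map_matrix Im (complex_gradient \<phi> p) = gradient (\<lambda>q. Im (\<phi> q)) p"
  by (simp_all add: vec_eq_iff complex_gradient_def)

lemma smooth_phi: "smooth (phi v a)"
proof -
  have "bounded_linear (\<lambda>A :: real^'a^'a. \<Sum>i\<in>UNIV. \<Sum>j\<in>UNIV. v $ i * a $ j * of_real (A $ i $ j))"
    by (intro bounded_linear_sum bounded_linear_compose[OF bounded_linear_mult_right]
        bounded_linear_compose[OF bounded_linear_of_real] bounded_linear_matrix_entry)
  from smooth_bounded_linear[OF this smooth_mat_of_SL] show ?thesis
    unfolding phi_eq[abs_def] .
qed

lemma tension_phi:
  fixes v :: "complex^'n::finite"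
  shows "tension (phi v a) x = - ((of_nat CARD('n))\<^sup>2 - 1) / of_nat CARD('n) * phi v a x"
proof -
  let ?c = "1 / CARD('n) - CARD('n) :: real"
  have "tension (phi v a) x = Complex (?c * Re (phi v a x)) (?c * Im (phi v a x))"
    by (simp add: tension_def complex_divergence_def map_matrix_complex_gradient Re_phi Im_phi
        gradient_entry_form divergence_entry_form_gradient fun_cong[OF Re_phi] fun_cong[OF Im_phi])
  also have "\<dots> = of_real ?c * phi v a x"
    by (simp add: complex_eq_iff)
  also have "of_real ?c = - ((of_nat CARD('n))\<^sup>2 - 1 :: complex) / of_nat CARD('n)"
    by (simp add: field_simps power2_eq_square)
  finally show ?thesis .
qed

text \<open>The summation order is chosen to match \<open>phi_mult_phi\<close> term by term.\<close>

lemma trace_transpose_mult_quadratic: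
  "trace (transpose M ** P ** (transpose N ** P))
    = (\<Sum>i\<in>UNIV. \<Sum>j\<in>UNIV. \<Sum>k\<in>UNIV. \<Sum>l\<in>UNIV. M $ j $ i * P $ j $ k * (N $ l $ k * P $ l $ i))"
proof -
  have "trace (transpose M ** P ** (transpose N ** P))
    = (\<Sum>i\<in>UNIV. \<Sum>k\<in>UNIV. (\<Sum>j\<in>UNIV. M $ j $ i * P $ j $ k) * (\<Sum>l\<in>UNIV. N $ l $ k * P $ l $ i))"
    by (simp add: trace_def matrix_matrix_mult_def transpose_def)
  also have "\<dots> = (\<Sum>i\<in>UNIV. \<Sum>k\<in>UNIV. \<Sum>j\<in>UNIV. \<Sum>l\<in>UNIV. M $ j $ i * P $ j $ k * (N $ l $ k * P $ l $ i))"
    by (simp add: sum_product)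
  also have "\<dots> = (\<Sum>i\<in>UNIV. \<Sum>j\<in>UNIV. \<Sum>k\<in>UNIV. \<Sum>l\<in>UNIV. M $ j $ i * P $ j $ k * (N $ l $ k * P $ l $ i))"
    by (intro sum.cong refl sum.swap)
  finally show ?thesis .
qed

text \<open>For \<open>K = v\<^sup>t a\<close> and \<open>L = v\<^sup>t b\<close> one has \<open>trace (K\<^sup>t x L\<^sup>t x) = (v x b\<^sup>t) (v x a\<^sup>t)\<close>: this is where
  the common \<open>v\<close> is used.\<close>

lemma phi_mult_phi:
  "phi v a x * phi v b x = (\<Sum>i\<in>UNIV. \<Sum>j\<in>UNIV. \<Sum>k\<in>UNIV. \<Sum>l\<in>UNIV.
     (v $ j * a $ i) * mat_of_SL x $ j $ k * ((v $ l * b $ k) * mat_of_SL x $ l $ i))"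
proof -
  let ?P = "\<lambda>i j. of_real (mat_of_SL x $ i $ j) :: complex"
  have "phi v a x * phi v b x = (\<Sum>l\<in>UNIV. \<Sum>i\<in>UNIV. v $ l * a $ i * ?P l i) * (\<Sum>j\<in>UNIV. \<Sum>k\<in>UNIV. v $ j * b $ k * ?P j k)"
    by (simp add: phi_eq)
  also have "(\<Sum>l\<in>UNIV. \<Sum>i\<in>UNIV. v $ l * a $ i * ?P l i) = (\<Sum>i\<in>UNIV. \<Sum>l\<in>UNIV. v $ l * a $ i * ?P l i)"
    by (rule sum.swap)
  also have "\<dots> * (\<Sum>j\<in>UNIV. \<Sum>k\<in>UNIV. v $ j * b $ k * ?P j k)
    = (\<Sum>i\<in>UNIV. \<Sum>j\<in>UNIV. (\<Sum>l\<in>UNIV. v $ l * a $ i * ?P l i) * (\<Sum>k\<in>UNIV. v $ j * b $ k * ?P j k))"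
    by (rule sum_product)
  also have "\<dots> = (\<Sum>i\<in>UNIV. \<Sum>j\<in>UNIV. \<Sum>l\<in>UNIV. \<Sum>k\<in>UNIV. (v $ l * a $ i * ?P l i) * (v $ j * b $ k * ?P j k))"
    by (simp only: sum_product)
  also have "\<dots> = (\<Sum>i\<in>UNIV. \<Sum>j\<in>UNIV. \<Sum>k\<in>UNIV. \<Sum>l\<in>UNIV. (v $ l * a $ i * ?P l i) * (v $ j * b $ k * ?P j k))"
    by (intro sum.cong refl sum.swap)
  finally show ?thesis by (simp add: mult_ac)
qed

lemma conformality_phi:
  fixes v :: "complex^'n::finite"
  shows "conformality (phi v a) (phi v b) x
    = - (of_nat CARD('n) - 1) / of_nat CARD('n) * phi v a x * phi v b x"
proof -
  let ?K = "row_outer v a" and ?L = "row_outer v b" and ?P = "mat_of_SL x"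
  let ?q = "\<lambda>M N. trace (transpose M ** ?P ** (transpose N ** ?P))"
  \<comment> \<open>The four real values assemble into the complex-bilinear extension of
    \<open>?q\<close>, evaluated at \<open>?K\<close> and \<open>?L\<close>.\<close>
  have "Complex (?q (map_matrix Re ?K) (map_matrix Re ?L) - ?q (map_matrix Im ?K) (map_matrix Im ?L))
      (?q (map_matrix Re ?K) (map_matrix Im ?L) + ?q (map_matrix Im ?K) (map_matrix Re ?L))
    = (\<Sum>i\<in>UNIV. \<Sum>j\<in>UNIV. \<Sum>k\<in>UNIV. \<Sum>l\<in>UNIV.
        ?K $ j $ i * ?P $ j $ k * (?L $ l $ k * ?P $ l $ i))"
    unfolding trace_transpose_mult_quadratic complex_eq_iff
    by (simp add: sum_subtractf[symmetric] sum.distrib[symmetric] algebra_simps)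
  also have "\<dots> = phi v a x * phi v b x"
    by (simp add: phi_mult_phi row_outer_def)
  finally have "Complex (?q (map_matrix Re ?K) (map_matrix Re ?L) - ?q (map_matrix Im ?K) (map_matrix Im ?L))
      (?q (map_matrix Re ?K) (map_matrix Im ?L) + ?q (map_matrix Im ?K) (map_matrix Re ?L))
    = phi v a x * phi v b x" .
  from arg_cong[OF this, of Re] arg_cong[OF this, of Im]
  have q: "?q (map_matrix Re ?K) (map_matrix Re ?L) - ?q (map_matrix Im ?K) (map_matrix Im ?L)
      = Re (phi v a x * phi v b x)"
    "?q (map_matrix Re ?K) (map_matrix Im ?L) + ?q (map_matrix Im ?K) (map_matrix Re ?L)
      = Im (phi v a x * phi v b x)"
    by (simp_all only: complex.sel)
  \<comment> \<open>The 1/n comes from the trace correction in the gradients, the -1 from the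
    quadratic term, which \<open>q\<close> identifies with the product.\<close>
  let ?c = "1 / CARD('n) - 1 :: real"
  note e = fun_cong[OF Re_phi, symmetric] fun_cong[OF Im_phi, symmetric]
  have "conformality (phi v a) (phi v b) x
    = Complex (?c * Re (phi v a x * phi v b x)) (?c * Im (phi v a x * phi v b x))"
    using q unfolding conformality_def complex_metric_def map_matrix_complex_gradient Re_phi Im_phi
      gradient_entry_form metric_gradients e
    by (simp add: diff_divide_distrib add_divide_distrib algebra_simps)
  also have "\<dots> = of_real ?c * (phi v a x * phi v b x)"
    by (simp only: complex_eq_iff Re_complex_of_real) simp
  also have "of_real ?c = - (of_nat CARD('n) - 1 :: complex) / of_nat CARD('n)"
    by (simp add: field_simps)
  finally show ?thesis by (simp add: mult.assoc)
qed

section \<open>Linear structure and dimension of the family\<close>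

lemma phi_add: "phi v a x + phi v b x = phi v (a + b) x"
  by (simp add: phi_eq sum.distrib[symmetric] algebra_simps)

lemma phi_scale: "c * phi v a x = phi v (c *s a) x"
  by (simp add: phi_eq sum_distrib_left mult_ac)

lemma phi_eq_vector_matrix:
  "phi v a x = (\<Sum>j\<in>UNIV. a $ j * (\<Sum>i\<in>UNIV. v $ i * of_real (mat_of_SL x $ i $ j)))"
  unfolding phi_eq by (subst sum.swap) (simp add: sum_distrib_left mult_ac)

text \<open>The value at x pairs \<open>a\<close> with the row vector v x. The identity gives v a^t
  = 0; where v_k is nonzero, the transvection adding row j to row k gives a_j v_k = 0 in addition,
  and the first equation then leaves a_k = 0.\<close>

lemma phi_eq_0_imp:
  fixes v :: "complex^'n::finite"
  assumes "v \<noteq> 0" and zero: "\<And>x. phi v a x = 0"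
  shows "a = 0"
proof -
  obtain k where k: "v $ k \<noteq> 0" using assms(1) by (auto simp: vec_eq_iff)
  have "det (mat 1 :: real^'n^'n) = 1" by simp
  then have one: "(\<Sum>i\<in>UNIV. v $ i * a $ i) = 0"
    using zero[of "SL_of_mat (mat 1)"]
    by (simp add: phi_eq_vector_matrix SL_of_mat_inverse mat_def if_distrib[of of_real]
        if_distrib[of "(*) _"] mult.commute cong: if_cong)
  have a: "a $ j = 0" if "j \<noteq> k" for j
  proof -
    define A :: "real^'n^'n" where "A = (\<chi> i. if i = k then row k (mat 1) + 1 *s row j (mat 1) else row i (mat 1))"
    have "det A = 1" using det_row_operation[of k j "mat 1" 1] that by (simp add: A_def)
    have A: "A $ i $ l = (if i = l then 1 else 0) + (if i = k \<and> l = j then 1 else 0)" for i l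
      by (auto simp: A_def row_def mat_def)
    have "0 = phi v a (SL_of_mat A)" by (simp add: zero)
    also have "\<dots> = (\<Sum>l\<in>UNIV. a $ l * (v $ l + (if l = j then v $ k else 0)))"
      unfolding phi_eq_vector_matrix using \<open>det A = 1\<close>
      by (intro sum.cong refl arg_cong2[of _ _ _ _ "(*)"])
         (simp add: SL_of_mat_inverse A if_distrib[of of_real] if_distrib[of "(*) _"] distrib_left sum.distrib cong: if_cong)
    also have "\<dots> = (\<Sum>l\<in>UNIV. v $ l * a $ l) + a $ j * v $ k"
      by (simp add: distrib_left sum.distrib if_distrib[of "(*) _"] mult.commute cong: if_cong)
    finally show ?thesis using one k by simp
  qed
  have "(\<Sum>i\<in>UNIV. v $ i * a $ i) = (\<Sum>i\<in>UNIV. if i = k then v $ k * a $ k else 0)"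
    by (rule sum.cong[OF refl]) (auto simp: a)
  then have "a $ k = 0" using one k by simp
  with a show ?thesis by (metis vec_eq_iff zero_index)
qed

lemma subspace_family: "module.subspace fun_scale (family v)"
proof -
  interpret vector_space "fun_scale :: complex \<Rightarrow> ('a SL \<Rightarrow> complex) \<Rightarrow> _"
    by (rule vector_space_fun_scale)
  have "phi v a + phi v b = phi v (a + b)" "fun_scale c (phi v a) = phi v (c *s a)" "0 = phi v 0" for a b c
    by (simp_all add: fun_eq_iff phi_add fun_scale_def phi_scale) (simp add: phi_eq)
  then show ?thesis
    unfolding subspace_def family_def by auto
qed

lemma sum_fun_apply: "(\<Sum>i\<in>I. f i) x = (\<Sum>i\<in>I. f i x)"
  by (induction I rule: infinite_finite_induct) simp_all

text \<open>Sending \<open>a\<close> to \<open>phi v a\<close> is a linear isomorphism onto the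
  family, so the images of the unit vectors form a basis. Injectivity is where \<open>v\<close>
  being non-zero enters.\<close>

lemma dim_family:
  fixes v :: "complex^'n::finite"
  assumes "v \<noteq> 0"
  shows "vector_space.dim fun_scale (family v) = CARD('n)"
proof -
  interpret vector_space "fun_scale :: complex \<Rightarrow> ('n SL \<Rightarrow> complex) \<Rightarrow> _"
    by (rule vector_space_fun_scale)
  let ?e = "\<lambda>k. phi v (axis k 1)"
  have phi_expand: "phi v a = (\<Sum>k\<in>UNIV. fun_scale (a $ k) (?e k))" for a
  proof
    fix x
    let ?w = "\<lambda>j. \<Sum>i\<in>UNIV. v $ i * complex_of_real (mat_of_SL x $ i $ j)"
    have "?e k x = ?w k" for k
      by (simp add: phi_eq_vector_matrix axis_def if_distrib[of "\<lambda>x. x * _"] cong: if_cong)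
    then show "phi v a x = (\<Sum>k\<in>UNIV. fun_scale (a $ k) (?e k)) x"
      by (simp add: phi_eq_vector_matrix[of v a] fun_scale_def sum_fun_apply)
  qed
  have inj_phi: "a = b" if "phi v a = phi v b" for a b
  proof -
    have "phi v (a - b) x = 0" for x
      using phi_add[of v "a - b" x b] fun_cong[OF that, of x] by simp
    then show ?thesis using phi_eq_0_imp[OF assms, of "a - b"] by simp
  qed
  \<comment> \<open>Independence and cardinality are stated for the set \<open>range ?e\<close>, so
    distinct indices must give distinct functions.\<close>
  have inj: "inj ?e"
  proof (rule injI)
    fix k l assume "?e k = ?e l"
    then have "axis k (1::complex) = axis l 1" by (rule inj_phi)
    then show "k = l" by (simp add: axis_eq_axis)
  qed
  have "independent (range ?e)"
    unfolding dependent_finite[OF finite_imageI[OF finite]]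
  proof clarify
    fix u k assume "(\<Sum>f\<in>range ?e. fun_scale (u f) f) = 0" and u: "u (?e k) \<noteq> 0"
    then have "(\<Sum>k\<in>UNIV. fun_scale (u (?e k)) (?e k)) = 0"
      by (simp add: sum.reindex[OF inj])
    then have "phi v (\<chi> k. u (?e k)) = phi v 0"
      unfolding phi_expand[of "\<chi> k. u (?e k)"] phi_expand[of 0] by simp
    then have "(\<chi> k. u (?e k)) = 0" by (rule inj_phi)
    then have "u (?e k) = 0" by (simp add: vec_eq_iff)
    with u show False by contradiction
  qed
  moreover have "span (range ?e) = span (family v)"
  proof (rule span_eq[THEN iffD2, OF conjI])
    show "range ?e \<subseteq> span (family v)"
      by (auto simp: family_def intro: span_base)
    show "family v \<subseteq> span (range ?e)"
    proof
      fix f assume "f \<in> family v"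
      then obtain a where "f = phi v a" by (auto simp: family_def)
      then have "f = (\<Sum>k\<in>UNIV. fun_scale (a $ k) (?e k))"
        by (simp only: phi_expand[of a])
      moreover have "\<dots> \<in> span (range ?e)"
        by (intro span_sum span_scale span_base rangeI)
      ultimately show "f \<in> span (range ?e)" by simp
    qed
  qed
  ultimately have "dim (family v) = card (range ?e)"
    using dim_eq_card by blast
  then show ?thesis by (simp add: card_image[OF inj])
qed

theorem theorem9p2:
  fixes v :: "complex^'n::finite"
  assumes "v \<noteq> 0"
  shows "module.subspace fun_scale (family v)
    \<and> vector_space.dim fun_scale (family v) = CARD('n)
    \<and> eigenfamily (family v)
    \<and> (\<forall>\<phi>\<in>family v. \<forall>\<psi>\<in>family v. \<forall>x.
         tension \<phi> x = - ((of_nat CARD('n))\<^sup>2 - 1) / of_nat CARD('n) * \<phi> x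
       \<and> conformality \<phi> \<psi> x = - (of_nat CARD('n) - 1) / of_nat CARD('n) * \<phi> x * \<psi> x)"
proof -
  have eq: "tension \<phi> x = - ((of_nat CARD('n))\<^sup>2 - 1) / of_nat CARD('n) * \<phi> x"
    "conformality \<phi> \<psi> x = - (of_nat CARD('n) - 1) / of_nat CARD('n) * \<phi> x * \<psi> x"
    if "\<phi> \<in> family v" "\<psi> \<in> family v" for \<phi> \<psi> x
    using that tension_phi conformality_phi unfolding family_def by blast+
  moreover have "smooth \<phi>" if "\<phi> \<in> family v" for \<phi>
    using that smooth_phi unfolding family_def by blast
  ultimately have "eigenfamily (family v)"
    unfolding eigenfamily_def by blast
  then show ?thesis
    using subspace_family dim_family[OF assms] eq by blast
qed

end
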